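(* Let $\alpha>-1$ be a real number and let $K$ be a positive integer. Given real numbers $\gamma_j$, $0\le j\le K$, with $\gamma_0=1$ and $\gamma_K\neq 0$, set $$Q(x)=\sum_{j=0}^K(-1)^j\gamma_j\,(x)_{K-j},\qquad q_n(x)=\sum_{j=0}^K\gamma_j\,\hat L^\alpha_{n-j}(x),\quad n\ge K,$$ and denote by $\theta_j$, $1\le j\le m$, the real zeros of $Q$ satisfying $\alpha+1\le\theta_j$ (counted with multiplicity), arranged in increasing order. (1) If $Q$ has only real zeros, then all the zeros of $q_n$ are real and simple for $n\ge n_1$, and positive and simple for $n\ge n_0$, where for $l=0,1$ $$n_l=\max\left(\{K\}\cup\{\lfloor\theta_i-\alpha+K\rfloor : 1\le i\le m-l\}\right).$$ In particular, if all the zeros of $Q$ are less than $\alpha+1$, then $n_0=n_1=K$. (2) If $Q$ has non-real zeros, then there exists a positive integer $n_0$, depending only on the non-real zeros of $Q$ and the real zeros $\theta_j$, $1\le j\le m$ (for the given $\alpha$ and $K$), such that all the zeros of $q_n$ are positive and simple for $n\ge n_0$. In all the cases, for $n$ big enough the zeros of $q_{n+1}$ interlace the zeros of $q_n$.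
   Context: $(u)_s=u(u+1)\cdots(u+s-1)$, $(u)_0=1$, is the Pochhammer symbol; $\lfloor x\rfloor$ is the greatest integer $\le x$. The Laguerre polynomials are $L_n^\alpha(x)=\sum_{j=0}^n\binom{n+\alpha}{n-j}\frac{(-x)^j}{j!}$ and $\hat L_n^\alpha=(-1)^n n!\,L_n^\alpha$ is the monic Laguerre polynomial of degree $n$. Interlacing: given two finite sets $U,V$ of real numbers ordered by size, $U$ strictly interlaces $V$ if $\min U<\min V$ and between any two consecutive elements of any of the two sets there exists one element of the other. If $U\cap V=W\ne\emptyset$, then $U$ interlaces $V$ if $U\setminus W$ strictly interlaces $V\setminus W$; if $U\cap V=\emptyset$, $U$ interlaces $V$ means that it strictly interlaces $V$. *)

theory Defs
  imports "HOL-Analysis.Analysis" "HOL-Computational_Algebra.Computational_Algebra"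
begin

definition laguerre :: "real \<Rightarrow> nat \<Rightarrow> real poly" where
  "laguerre \<alpha> n =
     (\<Sum>j\<le>n. monom (((real n + \<alpha>) gchoose (n - j)) * (-1) ^ j / fact j) j)"

definition monic_laguerre :: "real \<Rightarrow> nat \<Rightarrow> real poly" where
  "monic_laguerre \<alpha> n = smult ((-1) ^ n * fact n) (laguerre \<alpha> n)"

(* pochhammer [:0, 1:] s is (x)_s = x (x + 1) ... (x + s - 1) as a polynomial in x. *)
definition Q_poly :: "nat \<Rightarrow> (nat \<Rightarrow> real) \<Rightarrow> real poly" where
  "Q_poly K \<gamma> = (\<Sum>j\<le>K. smult ((-1) ^ j * \<gamma> j) (pochhammer [:0, 1:] (K - j)))"

(* Only meaningful for n \<ge> K, since n - j is truncated subtraction. *)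
definition q_poly :: "real \<Rightarrow> nat \<Rightarrow> (nat \<Rightarrow> real) \<Rightarrow> nat \<Rightarrow> real poly" where
  "q_poly \<alpha> K \<gamma> n = (\<Sum>j\<le>K. smult (\<gamma> j) (monic_laguerre \<alpha> (n - j)))"

text \<open>The zeros of a real polynomial are its complex zeros.\<close>

abbreviation cpoly :: "real poly \<Rightarrow> complex poly" where
  "cpoly p \<equiv> map_poly complex_of_real p"

definition only_real_zeros :: "real poly \<Rightarrow> bool" where
  "only_real_zeros p \<longleftrightarrow> (\<forall>z. poly (cpoly p) z = 0 \<longrightarrow> z \<in> \<real>)"

definition zeros_real_simple :: "real poly \<Rightarrow> bool" where
  "zeros_real_simple p \<longleftrightarrow>
     (\<forall>z. poly (cpoly p) z = 0 \<longrightarrow> z \<in> \<real> \<and> order z (cpoly p) = 1)"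

definition zeros_positive_simple :: "real poly \<Rightarrow> bool" where
  "zeros_positive_simple p \<longleftrightarrow>
     (\<forall>z. poly (cpoly p) z = 0 \<longrightarrow> z \<in> \<real> \<and> Re z > 0 \<and> order z (cpoly p) = 1)"

definition nonreal_zeros :: "real poly \<Rightarrow> complex multiset" where
  "nonreal_zeros p = filter_mset (\<lambda>z. z \<notin> \<real>) (proots (cpoly p))"

(* The real zeros \<ge> \<alpha> + 1 of Q with multiplicity, in increasing order;
   \<theta>_i is the entry with list index i - 1, and m is the length of the list. *)
definition thetas :: "real \<Rightarrow> nat \<Rightarrow> (nat \<Rightarrow> real) \<Rightarrow> real list" where
  "thetas \<alpha> K \<gamma> =
     sorted_list_of_multiset (filter_mset (\<lambda>x. \<alpha> + 1 \<le> x) (proots (Q_poly K \<gamma>)))"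

(* The number n_l. For m < l the truncated difference m - l is 0, so the index range
   1 \<le> i \<le> m - l is empty, as it should be. *)
definition n_bound :: "real \<Rightarrow> nat \<Rightarrow> (nat \<Rightarrow> real) \<Rightarrow> nat \<Rightarrow> int" where
  "n_bound \<alpha> K \<gamma> l =
     Max ({int K} \<union>
          (\<lambda>i. \<lfloor>thetas \<alpha> K \<gamma> ! (i - 1) - \<alpha> + real K\<rfloor>) ` {1..length (thetas \<alpha> K \<gamma>) - l})"

(* Every two consecutive elements of U have an element of V between them. *)
definition separated_by :: "real set \<Rightarrow> real set \<Rightarrow> bool" where
  "separated_by U V \<longleftrightarrow>
     (\<forall>x\<in>U. \<forall>y\<in>U. x < y \<and> U \<inter> {x<..<y} = {} \<longrightarrow> V \<inter> {x<..<y} \<noteq> {})"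

(* Nonemptiness is what min U < min V presupposes; Min {} is unspecified. *)
definition strictly_interlaces :: "real set \<Rightarrow> real set \<Rightarrow> bool" where
  "strictly_interlaces U V \<longleftrightarrow>
     finite U \<and> finite V \<and> U \<noteq> {} \<and> V \<noteq> {} \<and> Min U < Min V \<and>
     separated_by U V \<and> separated_by V U"

definition interlaces :: "real set \<Rightarrow> real set \<Rightarrow> bool" where
  "interlaces U V \<longleftrightarrow>
     (let W = U \<inter> V in
        if W = {} then strictly_interlaces U V else strictly_interlaces (U - W) (V - W))"

end

theory Submission
  imports Defs
begin

text \<open>Write \<open>L\<^sub>n\<close> for the monic Laguerre polynomial of degree \<open>n\<close> and \<open>D = d/dx\<close>. The operators
  \<open>R\<^sub>c f = x f' + (c - x) f = e\<^sup>x (x D + c) (e\<^sup>-\<^sup>x f)\<close> raise the degree by one, satisfy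
  \<open>R\<^sub>c\<^sub>+\<^sub>d = R\<^sub>c + d\<close>, and the one with \<open>c = n + \<alpha> + 1\<close> maps \<open>L\<^sub>n\<close> to \<open>- L\<^sub>n\<^sub>+\<^sub>1\<close>. Hence a Pochhammer symbol in
  that operator, applied to \<open>L\<^sub>k\<close>, gives \<open>L\<^sub>k\<^sub>+\<^sub>s\<close> up to sign, and \<open>q\<^sub>n\<close> is, up to sign, \<open>Q (R\<^sub>c)\<close> applied
  to \<open>L\<^sub>n\<^sub>-\<^sub>K\<close> with \<open>c = n - K + \<alpha> + 1\<close> (\<open>q_poly_eq_poly_op\<close>). A real zero \<open>\<theta>\<close> of \<open>Q\<close> contributes the factor
  \<open>R\<^sub>d\<close> with \<open>d = c - \<theta>\<close>. Since \<open>R\<^sub>d f = x f'\<close> at the zeros of \<open>f\<close>, such a step turns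
  positive simple zeros into real simple zeros, which are again positive if \<open>d > 0\<close>; the condition
  \<open>n \<ge> \<lfloor>\<theta> - \<alpha> + K\<rfloor>\<close> says just that \<open>d > 0\<close>. Taking the largest \<open>\<theta>\<close> last
  proves the first part.

  All statements on zeros go through one criterion (\<open>interlacing_of_signs\<close>): if \<open>f\<close> is monic with
  simple real zeros and \<open>g\<close> is monic of degree one more with \<open>g f' < 0\<close> at the zeros of \<open>f\<close>, then the
  partial fraction expansion of \<open>g / f\<close> shows that it is a Herglotz function; so \<open>g\<close> has real simple
  zeros which interlace those of \<open>f\<close>, and \<open>f g' > 0\<close> at them.

  For large \<open>n\<close> and arbitrary \<open>\<gamma>\<close>, the three-term recurrence shows that on the range of the zeros
  \<open>L\<^sub>n\<^sub>-\<^sub>j\<close> is at most of order \<open>1 / n ^ j\<close> times the larger of \<open>L\<^sub>n\<close> and \<open>n L\<^sub>n\<^sub>-\<^sub>1\<close>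
  (\<open>monic_laguerre_bound_left\<close>). So at the zeros of \<open>L\<^sub>n\<^sub>-\<^sub>1\<close> the polynomial \<open>q\<^sub>n\<close> has the sign of \<open>L\<^sub>n\<close>, and
  at the zeros of \<open>q\<^sub>n\<close> the polynomial \<open>q\<^sub>n\<^sub>+\<^sub>1\<close> has the sign opposite to \<open>L\<^sub>n\<^sub>-\<^sub>1\<close>. The criterion, applied to
  \<open>(L\<^sub>n\<^sub>-\<^sub>1, q\<^sub>n)\<close> and then to \<open>(q\<^sub>n, q\<^sub>n\<^sub>+\<^sub>1)\<close>, gives positive simple zeros and interlacing for large \<open>n\<close>
  (\<open>q_poly_laguerre_signs\<close>, \<open>q_poly_Suc_interlaces\<close>).

  For the second part, split \<open>Q\<close> into its real linear factors and a monic cofactor, which depends only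
  on the nonreal zeros. The operator of the cofactor produces a polynomial of the form \<open>q\<^sub>n\<close> again, for
  another sequence \<open>\<gamma>\<close>, so its zeros are positive and simple for large \<open>n\<close>; the remaining raising steps
  preserve this as soon as \<open>n\<close> also exceeds the bounds that come from the \<open>\<theta>\<close>
  (\<open>uniform_positivity_bound\<close>).\<close>

section \<open>Real polynomials seen over the complex numbers\<close>

lemma cpoly_mult: "cpoly (p * q) = cpoly p * cpoly q"
  by (intro poly_eqI) (simp add: coeff_map_poly coeff_mult)

lemma cpoly_diff: "cpoly (p - q) = cpoly p - cpoly q"
  by (intro poly_eqI) (simp add: coeff_map_poly)

lemma cpoly_sum: "cpoly (\<Sum>x\<in>A. f x) = (\<Sum>x\<in>A. cpoly (f x))"
  by (intro poly_eqI) (simp add: coeff_map_poly coeff_sum)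

lemma cpoly_prod: "cpoly (\<Prod>x\<in>A. f x) = (\<Prod>x\<in>A. cpoly (f x))"
  by (induction A rule: infinite_finite_induct) (auto simp: cpoly_mult)

lemma cpoly_smult: "cpoly (smult c p) = smult (complex_of_real c) (cpoly p)"
  by (intro poly_eqI) (simp add: coeff_map_poly)

lemma cpoly_inject: "cpoly p = cpoly q \<longleftrightarrow> p = q"
  by (auto simp: poly_eq_iff coeff_map_poly)

lemma cpoly_pderiv: "pderiv (cpoly p) = cpoly (pderiv p)"
  by (intro poly_eqI) (simp add: coeff_map_poly coeff_pderiv)

lemma poly_cpoly_of_real: "poly (cpoly p) (complex_of_real x) = complex_of_real (poly p x)"
  by (induction p) (auto simp: map_poly_pCons)

lemma cpoly_eq_0_iff [simp]: "cpoly p = 0 \<longleftrightarrow> p = 0"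
  by (simp add: map_poly_eq_0_iff)

lemma lead_coeff_cpoly: "lead_coeff (cpoly p) = complex_of_real (lead_coeff p)"
  by (simp add: lead_coeff_map_poly_nz degree_map_poly coeff_map_poly)

lemma order_one_iff:
  fixes p :: "complex poly"
  assumes "p \<noteq> 0" "poly p z = 0"
  shows "order z p = 1 \<longleftrightarrow> poly (pderiv p) z \<noteq> 0"
proof (cases "pderiv p = 0")
  case True
  then obtain h where "p = [:h:]" using pderiv_iszero by blast
  with assms show ?thesis by simp
next
  case False
  with order_pderiv[OF assms] order_root[of "pderiv p" z] show ?thesis by auto
qed

lemma pderiv_sum: "pderiv (\<Sum>x\<in>A. f x) = (\<Sum>x\<in>A. pderiv (f x))"
  by (induction A rule: infinite_finite_induct) (auto simp: pderiv_add)

section \<open>Polynomials with given simple zeros\<close>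

definition root_poly :: "'a::comm_ring_1 set \<Rightarrow> 'a poly" where
  "root_poly S = (\<Prod>z\<in>S. [:- z, 1:])"

lemma poly_root_poly: "poly (root_poly S) x = (\<Prod>z\<in>S. x - z)"
  by (simp add: root_poly_def poly_prod)

lemma root_poly_eq_0_iff:
  fixes x :: "'a::idom"
  shows "finite S \<Longrightarrow> poly (root_poly S) x = 0 \<longleftrightarrow> x \<in> S"
  by (auto simp: poly_root_poly prod_zero_iff)

lemma degree_root_poly: "degree (root_poly S :: 'a::idom poly) = card S"
  by (simp add: root_poly_def degree_prod_sum_eq)

lemma lead_coeff_root_poly: "lead_coeff (root_poly S :: 'a::idom poly) = 1"
  by (simp only: root_poly_def lead_coeff_prod) simp

lemma root_poly_remove:
  "finite S \<Longrightarrow> z \<in> S \<Longrightarrow> root_poly S = [:- z, 1:] * root_poly (S - {z})"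
  unfolding root_poly_def by (rule prod.remove)

lemma pderiv_root_poly_at_root:
  assumes "finite S" "z \<in> S"
  shows "poly (pderiv (root_poly S)) z = poly (root_poly (S - {z})) z"
  by (simp only: root_poly_remove[OF assms] pderiv_mult) (simp add: pderiv_pCons)

lemma root_poly_ne_0 [simp]: "root_poly S \<noteq> (0 :: 'a::idom poly)"
  using lead_coeff_root_poly[of S] by force

lemma cpoly_root_poly: "cpoly (root_poly S) = (\<Prod>z\<in>S. [:- complex_of_real z, 1:])"
  by (simp add: root_poly_def cpoly_prod map_poly_pCons)

lemma zeros_real_simple_iff:
  assumes "p \<noteq> 0"
  shows "zeros_real_simple p \<longleftrightarrow>
    only_real_zeros p \<and> (\<forall>x. poly p x = 0 \<longrightarrow> poly (pderiv p) x \<noteq> 0)"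
proof -
  have "order (complex_of_real x) (cpoly p) = 1 \<longleftrightarrow> poly (pderiv p) x \<noteq> 0" if "poly p x = 0" for x
    using that assms order_one_iff[of "cpoly p" "complex_of_real x"]
    by (simp add: cpoly_pderiv poly_cpoly_of_real)
  then show ?thesis
    unfolding zeros_real_simple_def only_real_zeros_def
    by (metis Reals_cases of_real_eq_0_iff poly_cpoly_of_real Reals_of_real)
qed

lemma zeros_positive_simple_iff:
  "zeros_positive_simple p \<longleftrightarrow> zeros_real_simple p \<and> (\<forall>x. poly p x = 0 \<longrightarrow> x > 0)"
  unfolding zeros_real_simple_def zeros_positive_simple_def
  by (metis Reals_cases of_real_eq_0_iff poly_cpoly_of_real Re_complex_of_real)

lemma zeros_real_simple_imp_ne_0: "zeros_real_simple p \<Longrightarrow> p \<noteq> 0"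
  unfolding zeros_real_simple_def by (metis complex_is_Real_iff complex_i_not_zero imaginary_unit.simps(2) map_poly_0 poly_0 zero_neq_one)

lemma zeros_real_simple_eq_root_poly:
  assumes "zeros_real_simple p"
  shows "p = smult (lead_coeff p) (root_poly {x. poly p x = 0})"
proof -
  have p0: "p \<noteq> 0" using zeros_real_simple_imp_ne_0[OF assms] .
  let ?Z = "{x. poly p x = 0}"
  have "rsquarefree (cpoly p)"
    unfolding rsquarefree_def using p0 assms
    by (auto simp: zeros_real_simple_def order_root)
  from complex_poly_decompose_rsquarefree[OF this]
  have "cpoly p = smult (lead_coeff (cpoly p)) (\<Prod>z | poly (cpoly p) z = 0. [:- z, 1:])" by simp
  also have "{z. poly (cpoly p) z = 0} = complex_of_real ` ?Z"
  proof (intro equalityI subsetI)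
    fix z assume "z \<in> {z. poly (cpoly p) z = 0}"
    with assms obtain x where "z = complex_of_real x" "poly (cpoly p) z = 0"
      unfolding zeros_real_simple_def by (metis Reals_cases mem_Collect_eq)
    then show "z \<in> complex_of_real ` ?Z" by (simp add: poly_cpoly_of_real)
  qed (force simp: poly_cpoly_of_real)
  also have "(\<Prod>z\<in>complex_of_real ` ?Z. [:- z, 1:]) = cpoly (root_poly ?Z)"
    by (subst prod.reindex) (auto simp: inj_on_def cpoly_root_poly)
  also have "smult (lead_coeff (cpoly p)) \<dots> = cpoly (smult (lead_coeff p) (root_poly ?Z))"
    by (simp only: lead_coeff_cpoly cpoly_smult)
  finally show ?thesis by (simp only: cpoly_inject)
qed

section \<open>Interlacing from sign conditions\<close>

text \<open>The derivative of a polynomial with simple zeros changes sign from one zero to the next,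
  hence so does any \<open>h\<close> whose sign at the zeros is tied to it. The factor \<open>s\<close> fixes which of
  the two signs the tie has.\<close>

lemma separated_by_of_signs:
  assumes "finite S" and sgn: "\<And>z. z \<in> S \<Longrightarrow> s * poly h z * poly (pderiv (root_poly S)) z > 0"
  shows "separated_by S {x::real. poly h x = 0}"
  unfolding separated_by_def
proof (intro ballI impI)
  fix x y assume x: "x \<in> S" and y: "y \<in> S" and xy: "x < y \<and> S \<inter> {x<..<y} = {}"
  define R where "R = S - {x} - {y}"
  have fin: "finite R" and "finite (S - {x})" "finite (S - {y})" using assms by (auto simp: R_def)
  have R': "R = S - {y} - {x}" by (auto simp: R_def)
  have fx: "poly (pderiv (root_poly S)) x = (x - y) * (\<Prod>w\<in>R. x - w)"
    using pderiv_root_poly_at_root[OF \<open>finite S\<close> x] prod.remove[of "S - {x}" y "\<lambda>w. x - w"]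
      xy y \<open>finite (S - {x})\<close> by (simp add: R_def poly_root_poly)
  have fy: "poly (pderiv (root_poly S)) y = (y - x) * (\<Prod>w\<in>R. y - w)"
    using pderiv_root_poly_at_root[OF \<open>finite S\<close> y] prod.remove[of "S - {y}" x "\<lambda>w. y - w"]
      xy x \<open>finite (S - {y})\<close> by (simp add: R' poly_root_poly)
  have "(x - w) * (y - w) > 0" if "w \<in> R" for w
  proof -
    have "w \<in> S" "w \<noteq> x" "w \<noteq> y" using that by (auto simp: R_def)
    with xy have "w < x \<or> w > y" by force
    then show ?thesis using xy by (auto intro: mult_neg_neg)
  qed
  then have "0 < (\<Prod>w\<in>R. (x - w) * (y - w))" by (intro prod_pos) auto
  then have P: "0 < (\<Prod>w\<in>R. x - w) * (\<Prod>w\<in>R. y - w)" by (simp add: prod.distrib)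
  have "poly (pderiv (root_poly S)) x * poly (pderiv (root_poly S)) y
      = - ((x - y)^2 * ((\<Prod>w\<in>R. x - w) * (\<Prod>w\<in>R. y - w)))"
    by (simp add: fx fy power2_eq_square algebra_simps)
  also have "\<dots> < 0" using P xy by simp
  finally have dd: "poly (pderiv (root_poly S)) x * poly (pderiv (root_poly S)) y < 0" .
  have "0 < (s * poly h x * poly (pderiv (root_poly S)) x) * (s * poly h y * poly (pderiv (root_poly S)) y)"
    using sgn[OF x] sgn[OF y] by (rule mult_pos_pos)
  also have "\<dots> = s^2 * ((poly h x * poly h y) * (poly (pderiv (root_poly S)) x * poly (pderiv (root_poly S)) y))"
    by (simp add: power2_eq_square algebra_simps)
  finally have "0 < (poly h x * poly h y) * (poly (pderiv (root_poly S)) x * poly (pderiv (root_poly S)) y)"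
    by (metis zero_less_mult_pos zero_le_power2 mult_zero_left order_le_less less_irrefl)
  with dd have "poly h x * poly h y < 0"
    by (metis mult_less_0_iff zero_less_mult_iff order_less_asym)
  then show "{x. poly h x = 0} \<inter> {x<..<y} \<noteq> {}"
    using poly_IVT[of x y h] xy by auto
qed

text \<open>This is \<open>g / f = x - a - (\<Sum>z\<in>S. c z / (x - z))\<close>, multiplied by \<open>f\<close>. The polynomial
  \<open>g - x f + (\<Sum>z\<in>S. c z f / (x - z))\<close> has degree at most \<open>card S\<close> and vanishes on \<open>S\<close>, so
  it is a constant multiple of \<open>f\<close>.\<close>

lemma partial_fractions:
  fixes g :: "'a::field poly"
  assumes "finite S" "degree g = Suc (card S)" "lead_coeff g = 1"
    and c: "\<And>z. z \<in> S \<Longrightarrow> c z * poly (root_poly (S - {z})) z = - poly g z"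
  obtains a where
    "g = [:- a, 1:] * root_poly S - (\<Sum>z\<in>S. smult (c z) (root_poly (S - {z})))"
proof -
  let ?f = "root_poly S" and ?n = "card S"
  define h where "h = g - pCons 0 ?f + (\<Sum>z\<in>S. smult (c z) (root_poly (S - {z})))"
  have sum_deg: "degree (\<Sum>z\<in>S. smult (c z) (root_poly (S - {z}))) \<le> ?n"
    by (intro degree_sum_le) (auto simp: degree_root_poly \<open>finite S\<close> intro!: order.trans[OF degree_smult_le] card_mono)
  have lf: "coeff ?f ?n = 1" using lead_coeff_root_poly[of S] by (simp add: degree_root_poly)
  have "degree (g - pCons 0 ?f) \<le> ?n"
  proof (rule degree_le, intro allI impI)
    fix i assume i: "?n < i"
    show "coeff (g - pCons 0 ?f) i = 0"
    proof (cases "i = Suc ?n")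
      case True
      then show ?thesis using assms lf by simp
    next
      case False
      then have "Suc ?n < i" using i by simp
      then have "coeff g i = 0" "coeff ?f (i - 1) = 0"
        using assms by (auto intro!: coeff_eq_0 simp: degree_root_poly)
      then show ?thesis using i by (cases i) auto
    qed
  qed
  then have dh: "degree h \<le> ?n" unfolding h_def using sum_deg degree_add_le by blast
  define k where "k = coeff h ?n"
  have "h = smult k ?f"
  proof (rule poly_eqI_degree_lead_coeff[where A = S and n = ?n])
    show "coeff h ?n = coeff (smult k ?f) ?n" using lf by (simp add: k_def)
    show "degree (smult k ?f) \<le> ?n"
      by (rule order.trans[OF degree_smult_le]) (simp add: degree_root_poly)
    fix z assume z: "z \<in> S"
    have "(\<Sum>w\<in>S. c w * poly (root_poly (S - {w})) z) = (\<Sum>w\<in>{z}. c w * poly (root_poly (S - {w})) z)"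
      using z \<open>finite S\<close> by (intro sum.mono_neutral_right) (auto simp: root_poly_eq_0_iff)
    then have "poly h z = 0"
      using z \<open>finite S\<close> c[OF z] by (simp add: h_def poly_sum root_poly_eq_0_iff)
    then show "poly h z = poly (smult k ?f) z"
      using z \<open>finite S\<close> by (simp add: root_poly_eq_0_iff)
  qed (use dh in auto)
  then have "g = [:k, 1:] * ?f - (\<Sum>z\<in>S. smult (c z) (root_poly (S - {z})))"
    unfolding h_def[symmetric] by (simp add: h_def algebra_simps)
  then show ?thesis using that[of "- k"] by simp
qed

text \<open>Under the sign hypothesis all numbers \<open>c z = - g z / f' z\<close> of the partial fraction expansion
  are positive, so \<open>g / f = x - a - (\<Sum>z\<in>S. c z / (x - z))\<close> maps the open upper half plane into
  itself and is increasing on each real interval that avoids \<open>S\<close>. The first property makes the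
  zeros of \<open>g\<close> real, the second gives the sign of \<open>f g'\<close> at them, hence simplicity and
  interlacing. If \<open>g / f\<close> is already negative at a point \<open>0\<close> to the left of \<open>S\<close>, monotonicity
  leaves no zero of \<open>g\<close> to the left of that point.

  The sign of \<open>f g'\<close> at the zeros of \<open>g\<close> is what a comparison of a third polynomial with \<open>g\<close>
  starts from.\<close>

lemma interlacing_of_signs:
  fixes g :: "real poly"
  assumes fin: "finite S" and deg: "degree g = Suc (card S)" and lc: "lead_coeff g = 1"
    and signs: "\<forall>z\<in>S. poly g z * poly (pderiv (root_poly S)) z < 0"
  shows "zeros_real_simple g"
    and "\<And>w. poly g w = 0 \<Longrightarrow> poly (root_poly S) w * poly (pderiv g) w > 0"
    and "\<And>w. \<forall>z\<in>S. 0 < z \<Longrightarrow> poly (root_poly S) 0 * poly g 0 < 0 \<Longrightarrow> poly g w = 0 \<Longrightarrow> 0 < w"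
    and "S \<noteq> {} \<Longrightarrow> interlaces {x. poly g x = 0} S"
proof -
  note sgn = signs[rule_format]
  let ?f = "root_poly S"
  define F where "F = (\<lambda>z. root_poly (S - {z}))"
  define c where "c = (\<lambda>z. - poly g z / poly (F z) z)"
  have Fz: "poly (F z) z = poly (pderiv ?f) z" if "z \<in> S" for z
    using pderiv_root_poly_at_root[OF fin that] by (simp add: F_def)
  have F0: "poly (F z) z \<noteq> 0" if "z \<in> S" for z using sgn[OF that] Fz[OF that] by auto
  have cpos: "c z > 0" if "z \<in> S" for z
  proof -
    have "poly g z * poly (F z) z < 0" using sgn[OF that] by (simp add: Fz[OF that])
    then show ?thesis unfolding c_def by (simp add: mult_less_0_iff divide_less_0_iff)
  qed
  have cF: "c z * poly (root_poly (S - {z})) z = - poly g z" if "z \<in> S" for z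
    using F0[OF that] by (simp add: c_def F_def)
  obtain a where g: "g = [:- a, 1:] * ?f - (\<Sum>z\<in>S. smult (c z) (F z))"
    unfolding F_def by (rule partial_fractions[OF fin deg lc, where c = c]) (use cF in blast)+
  have notS: "w \<notin> S" if "poly g w = 0" for w using sgn[of w] that by auto
  have f_split: "poly ?f w = (w - z) * poly (F z) w" if "z \<in> S" for z w
    using prod.remove[OF fin that, of "\<lambda>x. w - x"] by (simp add: F_def poly_root_poly)
  have g_eval: "poly g w = poly ?f w * (w - a - (\<Sum>z\<in>S. c z / (w - z)))" if "w \<notin> S" for w
  proof -
    have "(\<Sum>z\<in>S. c z * poly (F z) w) = (\<Sum>z\<in>S. poly ?f w * (c z / (w - z)))"
      using that by (intro sum.cong refl) (auto simp: f_split)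
    then show ?thesis
      by (simp add: g poly_sum sum_distrib_left algebra_simps)
  qed
  have root: "w - a - (\<Sum>z\<in>S. c z / (w - z)) = 0" if "poly g w = 0" for w
    using g_eval[OF notS[OF that]] that notS[OF that] fin by (simp add: root_poly_eq_0_iff)
  have real: "w \<in> \<real>" if "poly (cpoly g) w = 0" for w
  proof (rule ccontr)
    assume w: "w \<notin> \<real>"
    then have ne: "w \<noteq> complex_of_real z" for z by auto
    let ?P = "\<Prod>z\<in>S. w - complex_of_real z"
    have P0: "?P \<noteq> 0" using ne fin by (simp add: prod_zero_iff)
    have "poly (cpoly g) w = (w - a) * ?P - (\<Sum>z\<in>S. c z * (\<Prod>x\<in>S - {z}. w - complex_of_real x))"
      unfolding g F_def cpoly_diff cpoly_mult cpoly_sum cpoly_smult cpoly_root_poly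
      by (simp add: map_poly_pCons poly_sum poly_prod left_diff_distrib)
    also have "(\<Sum>z\<in>S. c z * (\<Prod>x\<in>S - {z}. w - complex_of_real x)) = (\<Sum>z\<in>S. ?P * (c z / (w - z)))"
      using ne by (intro sum.cong refl) (simp add: prod.remove[OF fin])
    finally have "?P * (w - a - (\<Sum>z\<in>S. c z / (w - z))) = 0"
      using that by (simp add: sum_distrib_left algebra_simps)
    then have "w - a - (\<Sum>z\<in>S. c z / (w - z)) = 0" using P0 by simp
    \<comment> \<open>The imaginary part is \<open>Im w\<close> times a number that is at least \<open>1\<close>.\<close>
    then have "Im (w - a - (\<Sum>z\<in>S. c z / (w - z))) = 0" by simp
    moreover have "Im (c z / (w - z)) = - Im w * (c z / (cmod (w - z))\<^sup>2)" for z
      by (simp add: Im_divide cmod_power2)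
    ultimately have "Im w * (1 + (\<Sum>z\<in>S. c z / (cmod (w - z))\<^sup>2)) = 0"
      by (simp add: sum_distrib_left sum_negf algebra_simps)
    moreover have "(\<Sum>z\<in>S. c z / (cmod (w - z))\<^sup>2) \<ge> 0"
      using cpos by (intro sum_nonneg) (auto simp: less_imp_le)
    ultimately show False using w by (auto simp: complex_is_Real_iff)
  qed
  show der: "poly ?f w * poly (pderiv g) w > 0" if "poly g w = 0" for w
  proof -
    have w: "w \<notin> S" using notS[OF that] .
    let ?f' = "poly (pderiv ?f) w"
    have "poly (pderiv (F z)) w = ?f' / (w - z) - poly ?f w / (w - z)\<^sup>2" if z: "z \<in> S" for z
    proof -
      have "?f' = poly (F z) w + (w - z) * poly (pderiv (F z)) w"
        by (subst root_poly_remove[OF fin z], subst pderiv_mult) (simp add: F_def pderiv_pCons algebra_simps)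
      moreover have "w - z \<noteq> 0" using w z by auto
      ultimately show ?thesis
        by (simp only: f_split[OF z, of w]) (simp add: add_divide_distrib power2_eq_square)
    qed
    then have "(\<Sum>z\<in>S. c z * poly (pderiv (F z)) w)
        = (\<Sum>z\<in>S. ?f' * (c z / (w - z)) - poly ?f w * (c z / (w - z)\<^sup>2))"
      by (intro sum.cong refl) (simp add: right_diff_distrib mult_ac)
    also have "\<dots> = ?f' * (w - a) - poly ?f w * (\<Sum>z\<in>S. c z / (w - z)\<^sup>2)"
      using root[OF that] by (simp add: sum_subtractf sum_distrib_left)
    finally have "poly (pderiv g) w = poly ?f w * (1 + (\<Sum>z\<in>S. c z / (w - z)\<^sup>2))"
      unfolding g pderiv_diff pderiv_mult pderiv_sum pderiv_smult
      by (simp add: pderiv_pCons poly_sum algebra_simps)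
    then have "poly ?f w * poly (pderiv g) w = (poly ?f w)\<^sup>2 * (1 + (\<Sum>z\<in>S. c z / (w - z)\<^sup>2))"
      by (simp add: power2_eq_square)
    moreover have "(\<Sum>z\<in>S. c z / (w - z)\<^sup>2) \<ge> 0"
      using cpos by (intro sum_nonneg) (auto simp: less_imp_le)
    ultimately show ?thesis using w fin by (simp add: root_poly_eq_0_iff)
  qed
  have g0: "g \<noteq> 0" using lc by auto
  show simple: "zeros_real_simple g"
    unfolding zeros_real_simple_iff[OF g0] only_real_zeros_def using real der by force
  show "0 < w" if "\<forall>z\<in>S. 0 < z" and sg: "poly ?f 0 * poly g 0 < 0" and w: "poly g w = 0" for w
  proof (rule ccontr)
    note pos = \<open>\<forall>z\<in>S. 0 < z\<close>[rule_format]
    assume "\<not> 0 < w"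
    then have w0: "w \<le> 0" by simp
    have "0 \<notin> S" using pos by force
    have "(\<Sum>z\<in>S. c z / (0 - z)) \<le> (\<Sum>z\<in>S. c z / (w - z))"
    proof (rule sum_mono)
      fix z assume "z \<in> S"
      with pos[of z] cpos[of z] w0 show "c z / (0 - z) \<le> c z / (w - z)"
        by (simp add: field_simps mult_nonpos_nonneg)
    qed
    then have "0 - a - (\<Sum>z\<in>S. c z / (0 - z)) \<ge> 0" using root[OF w] w0 by simp
    then have "(poly ?f 0)\<^sup>2 * (0 - a - (\<Sum>z\<in>S. c z / (0 - z))) \<ge> 0"
      by (intro mult_nonneg_nonneg) auto
    then have "poly ?f 0 * poly g 0 \<ge> 0"
      unfolding g_eval[OF \<open>0 \<notin> S\<close>] by (simp only: power2_eq_square mult.assoc)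
    with sg show False by simp
  qed
  show "interlaces {x. poly g x = 0} S" if "S \<noteq> {}"
  proof -
    define T where "T = {x. poly g x = 0}"
    have finT: "finite T" using g0 by (simp add: T_def poly_roots_finite)
    have gT: "g = root_poly T"
      using zeros_real_simple_eq_root_poly[OF simple] lc by (simp add: T_def)
    have cardT: "card T = Suc (card S)" using deg gT degree_root_poly[of T] by simp
    then have "T \<noteq> {}" by auto
    have "separated_by S {x. poly g x = 0}"
      by (rule separated_by_of_signs[OF fin, of "-1"]) (use sgn in auto)
    moreover have "separated_by T {x. poly ?f x = 0}"
      by (rule separated_by_of_signs[OF finT, of "1"]) (use der in \<open>auto simp: T_def gT[unfolded T_def, symmetric]\<close>)
    moreover have "{x. poly ?f x = 0} = S" using fin by (simp add: root_poly_eq_0_iff)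
    \<comment> \<open>If no zero of \<open>g\<close> preceded the least zero of \<open>f\<close>, then at that point the signs of \<open>g\<close>
      and \<open>f'\<close> would be read off from the numbers of factors, which have equal parity.\<close>
    moreover have "Min T < Min S"
    proof (rule ccontr)
      let ?z = "Min S"
      assume "\<not> Min T < ?z"
      have zS: "?z \<in> S" using fin that by simp
      have "?z \<notin> T" using notS zS by (auto simp: T_def)
      have 1: "(-1) ^ card T * poly g ?z > 0"
      proof -
        have "(-1) ^ card T * poly g ?z = (\<Prod>w\<in>T. w - ?z)"
          by (simp add: gT poly_root_poly flip: prod_constant prod.distrib)
        also have "\<dots> > 0"
        proof (rule prod_pos)
          fix w assume "w \<in> T"
          then have "Min T \<le> w" "w \<noteq> ?z" using finT \<open>?z \<notin> T\<close> by auto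
          with \<open>\<not> Min T < ?z\<close> show "0 < w - ?z" by simp
        qed
        finally show ?thesis .
      qed
      have 2: "(-1) ^ card (S - {?z}) * poly (pderiv ?f) ?z > 0"
      proof -
        have "(-1) ^ card (S - {?z}) * poly (pderiv ?f) ?z = (\<Prod>w\<in>S - {?z}. w - ?z)"
          by (simp add: Fz[OF zS, symmetric] F_def poly_root_poly flip: prod_constant prod.distrib)
        also have "\<dots> > 0" using Min_le[OF fin] by (intro prod_pos) force
        finally show ?thesis .
      qed
      have card: "card T = Suc (Suc (card (S - {?z})))"
        using cardT card.remove[OF fin zS] by (simp only:)
      have "0 < ((-1) ^ card (S - {?z}) * (-1) ^ card (S - {?z})) * (poly g ?z * poly (pderiv ?f) ?z)"
        using mult_pos_pos[OF 1 2] unfolding card power_Suc by (simp only: mult_ac mult_minus1 mult_minus1_right minus_minus) 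
      also have "(-1) ^ card (S - {?z}) * (-1) ^ card (S - {?z}) = (1 :: real)"
        by (simp flip: power_mult_distrib)
      finally show False using sgn[OF zS] by (simp only: mult_1)
    qed
    moreover have "T \<inter> S = {}" using notS by (auto simp: T_def)
    ultimately show ?thesis
      using fin finT that \<open>T \<noteq> {}\<close> by (simp add: interlaces_def strictly_interlaces_def T_def)
  qed
qed

section \<open>Monic Laguerre polynomials\<close>

lemma coeff_monic_laguerre:
  "coeff (monic_laguerre \<alpha> n) i =
    (if i \<le> n then (-1) ^ (n - i) * real (n choose i) * pochhammer (\<alpha> + real i + 1) (n - i) else 0)"
proof (cases "i \<le> n")
  case True
  have "coeff (laguerre \<alpha> n) i = (\<Sum>j\<le>n. if j = i then ((real n + \<alpha>) gchoose (n - j)) * (-1) ^ j / fact j else 0)"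
    unfolding laguerre_def coeff_sum by (intro sum.cong) auto
  also have "\<dots> = ((real n + \<alpha>) gchoose (n - i)) * (-1) ^ i / fact i"
    using True by simp
  also have "((real n + \<alpha>) gchoose (n - i)) = pochhammer (\<alpha> + real i + 1) (n - i) / fact (n - i)"
    using True by (simp add: gbinomial_pochhammer' of_nat_diff add_ac)
  finally have "coeff (monic_laguerre \<alpha> n) i
      = (-1) ^ n * (-1) ^ i * (fact n / (fact i * fact (n - i))) * pochhammer (\<alpha> + real i + 1) (n - i)"
    by (simp add: monic_laguerre_def mult_ac)
  also have "(-1) ^ n * (-1) ^ i = ((-1) ^ (n - i) :: real)"
    using True by (metis (no_types, opaque_lifting) minus_one_power_iff even_add even_diff_nat linorder_not_le mult_minus1 mult_minus1_right mult_1 minus_minus)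
  also have "fact n / (fact i * fact (n - i)) = real (n choose i)"
    using True by (simp add: binomial_fact)
  finally show ?thesis using True by simp
next
  case False
  have "coeff (laguerre \<alpha> n) i = 0"
    unfolding laguerre_def coeff_sum using False by (intro sum.neutral) auto
  with False show ?thesis by (simp add: monic_laguerre_def)
qed

lemma monic_laguerre_0 [simp]: "monic_laguerre \<alpha> 0 = 1"
  by (intro poly_eqI) (auto simp: coeff_monic_laguerre)

lemma degree_monic_laguerre [simp]: "degree (monic_laguerre \<alpha> n) = n"
  by (intro antisym degree_le le_degree) (auto simp: coeff_monic_laguerre)

lemma lead_coeff_monic_laguerre [simp]: "coeff (monic_laguerre \<alpha> n) n = 1"
  by (simp add: coeff_monic_laguerre)

text \<open>With \<open>D = d/dx\<close> this is \<open>e\<^sup>x (x D + c) e\<^sup>-\<^sup>x\<close> applied to \<open>f\<close>. Multiplication by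
  \<open>e\<^sup>-\<^sup>x\<close> turns the Laguerre polynomials into series whose coefficients are quotients of Gamma
  functions, on which \<open>x D\<close> acts diagonally.\<close>

definition euler_raise :: "real \<Rightarrow> real poly \<Rightarrow> real poly" where
  "euler_raise c f = [:0, 1:] * pderiv f + [:c, -1:] * f"

lemma coeff_raise:
  "coeff (euler_raise c f) i = (real i + c) * coeff f i - (if i = 0 then 0 else coeff f (i - 1))"
  by (cases i) (simp_all add: euler_raise_def coeff_pderiv algebra_simps)

lemma euler_raise_monic_laguerre:
  "euler_raise (real n + \<alpha> + 1) (monic_laguerre \<alpha> n) = - monic_laguerre \<alpha> (Suc n)"
proof (intro poly_eqI)
  fix i
  define C where "C = (\<lambda>i. real (n choose i))"
  define P where "P = (\<lambda>i. pochhammer (\<alpha> + real i + 1) (n - i))"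
  consider "i = 0" | "i = Suc n" | "i > Suc n" | "0 < i" "i \<le> n" by linarith
  then show "coeff (euler_raise (real n + \<alpha> + 1) (monic_laguerre \<alpha> n)) i = coeff (- monic_laguerre \<alpha> (Suc n)) i"
  proof cases
    case 4
    then obtain j where j: "i = Suc j" by (cases i) auto
    with 4 have jn: "Suc j \<le> n" by simp
    have P1: "pochhammer (\<alpha> + real i + 1) (Suc n - i) = P i * (\<alpha> + real n + 1)"
      using 4 by (simp add: P_def Suc_diff_le pochhammer_Suc of_nat_diff)
    have P2: "pochhammer (\<alpha> + real j + 1) (n - j) = (\<alpha> + real j + 1) * P i"
      using jn by (simp add: P_def j Suc_diff_Suc[symmetric] pochhammer_rec add_ac)
    have S1: "(-1) ^ (Suc n - i) = - ((-1) ^ (n - i) :: real)"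
      using 4 by (simp add: Suc_diff_le)
    have S2: "(-1) ^ (n - j) = - ((-1) ^ (n - i) :: real)"
      using jn by (simp add: j Suc_diff_Suc[symmetric])
    have C: "(real n - real j) * C j = (real j + 1) * C i"
    proof -
      have "Suc j * (n choose Suc j) = (n - j) * (n choose j)"
        by (simp only: binomial_absorb_comp binomial_absorption)
      then have "real (Suc j * (n choose Suc j)) = real ((n - j) * (n choose j))" by simp
      then show ?thesis using jn by (simp add: C_def j of_nat_diff algebra_simps)
    qed
    have L1: "coeff (monic_laguerre \<alpha> n) i = (-1) ^ (n - i) * C i * P i"
      using 4 by (simp add: coeff_monic_laguerre C_def P_def)
    have L2: "coeff (monic_laguerre \<alpha> n) (i - 1) = - ((-1) ^ (n - i)) * C j * ((\<alpha> + real j + 1) * P i)"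
      using jn S2 by (simp add: coeff_monic_laguerre C_def P2 j)
    have "coeff (euler_raise (real n + \<alpha> + 1) (monic_laguerre \<alpha> n)) i
        = (-1) ^ (n - i) * P i * ((real i + (real n + \<alpha> + 1)) * C i + C j * (\<alpha> + real j + 1))"
      using 4 by (simp add: coeff_raise L1 L2[unfolded One_nat_def] algebra_simps)
    also have "(real i + (real n + \<alpha> + 1)) * C i + C j * (\<alpha> + real j + 1) = (C i + C j) * (\<alpha> + real n + 1)"
      using C by (simp add: j algebra_simps)
    also have "(-1) ^ (n - i) * P i * \<dots> = coeff (- monic_laguerre \<alpha> (Suc n)) i"
      using 4 P1 S1 by (simp add: coeff_monic_laguerre C_def j algebra_simps)
    finally show ?thesis .
  qed (auto simp: coeff_raise coeff_monic_laguerre pochhammer_Suc add_ac)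
qed

lemma X_pderiv_monic_laguerre:
  "[:0, 1:] * pderiv (monic_laguerre \<alpha> (Suc n)) = smult (real (Suc n)) (monic_laguerre \<alpha> (Suc n))
     + smult (real (Suc n) * (real (Suc n) + \<alpha>)) (monic_laguerre \<alpha> n)"
proof (intro poly_eqI)
  fix i
  have L: "coeff ([:0, 1:] * pderiv p) i = real i * coeff p i" for p :: "real poly"
    by (cases i) (simp_all add: coeff_pderiv)
  consider "i = Suc n" | "i > Suc n" | "i \<le> n" by linarith
  then show "coeff ([:0, 1:] * pderiv (monic_laguerre \<alpha> (Suc n))) i
    = coeff (smult (real (Suc n)) (monic_laguerre \<alpha> (Suc n))
     + smult (real (Suc n) * (real (Suc n) + \<alpha>)) (monic_laguerre \<alpha> n)) i"
  proof cases
    case 3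
    define P where "P = pochhammer (\<alpha> + real i + 1) (n - i)"
    define s where "s = ((-1) ^ (n - i) :: real)"
    have P1: "pochhammer (\<alpha> + real i + 1) (Suc n - i) = P * (\<alpha> + real n + 1)"
      using 3 by (simp add: P_def Suc_diff_le pochhammer_Suc of_nat_diff)
    have S1: "(-1) ^ (Suc n - i) = - s"
      using 3 by (simp add: Suc_diff_le s_def)
    have "(Suc n - i) * (Suc n choose i) = Suc n * (n choose i)"
      using binomial_absorb_comp[of "Suc n" i] by simp
    then have "real (Suc n - i) * real (Suc n choose i) = real (Suc n) * real (n choose i)"
      by (metis of_nat_mult)
    then have C: "(real n + 1 - real i) * real (Suc n choose i) = (real n + 1) * real (n choose i)"
      using 3 by (simp only: of_nat_diff of_nat_Suc le_SucI) (simp only: add.commute)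
    have "real i * (- s * real (Suc n choose i) * (P * (\<alpha> + real n + 1)))
      - real (Suc n) * (- s * real (Suc n choose i) * (P * (\<alpha> + real n + 1)))
      = s * P * (\<alpha> + real n + 1) * ((real n + 1 - real i) * real (Suc n choose i))"
      by (simp add: algebra_simps)
    also have "\<dots> = real (Suc n) * (real (Suc n) + \<alpha>) * (s * real (n choose i) * P)"
      unfolding C by (simp add: algebra_simps)
    finally show ?thesis
      using 3 unfolding L by (simp add: coeff_monic_laguerre P1 S1 P_def[symmetric] s_def[symmetric] del: binomial_Suc_Suc)
  qed (unfold L, simp_all add: coeff_monic_laguerre)
qed

text \<open>Eliminate the derivative between the raising relation and the lowering relation.\<close>

lemma monic_laguerre_rec:
  "poly (monic_laguerre \<alpha> (Suc (Suc n))) x =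
    (x - 2 * real (Suc n) - \<alpha> - 1) * poly (monic_laguerre \<alpha> (Suc n)) x
     - real (Suc n) * (real (Suc n) + \<alpha>) * poly (monic_laguerre \<alpha> n) x"
proof -
  have "- poly (monic_laguerre \<alpha> (Suc (Suc n))) x = poly (euler_raise (real (Suc n) + \<alpha> + 1) (monic_laguerre \<alpha> (Suc n))) x"
    by (simp only: euler_raise_monic_laguerre) simp
  also have "\<dots> = poly ([:0, 1:] * pderiv (monic_laguerre \<alpha> (Suc n))) x + (real (Suc n) + \<alpha> + 1 - x) * poly (monic_laguerre \<alpha> (Suc n)) x"
    by (simp add: euler_raise_def algebra_simps)
  also note X_pderiv_monic_laguerre
  finally show ?thesis by (simp add: algebra_simps)
qed

lemma monic_laguerre_1: "poly (monic_laguerre \<alpha> 1) x = x - \<alpha> - 1"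
proof -
  have "- poly (monic_laguerre \<alpha> (Suc 0)) x = poly (euler_raise (real 0 + \<alpha> + 1) (monic_laguerre \<alpha> 0)) x"
    by (simp only: euler_raise_monic_laguerre) simp
  then show ?thesis by (simp add: euler_raise_def)
qed

lemma monic_laguerre_at_0: "poly (monic_laguerre \<alpha> (Suc n)) 0 = - (real n + \<alpha> + 1) * poly (monic_laguerre \<alpha> n) 0"
proof -
  have "- poly (monic_laguerre \<alpha> (Suc n)) 0 = poly (euler_raise (real n + \<alpha> + 1) (monic_laguerre \<alpha> n)) 0"
    by (simp only: euler_raise_monic_laguerre) simp
  then show ?thesis by (simp add: euler_raise_def algebra_simps)
qed

section \<open>Raising operators preserve simple zeros\<close>

lemma euler_raise_smult: "euler_raise c (smult a f) = smult a (euler_raise c f)"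
  by (intro poly_eqI) (simp add: coeff_raise algebra_simps)

lemma euler_raise_add: "euler_raise c (f + g) = euler_raise c f + euler_raise c g"
  by (intro poly_eqI) (simp add: coeff_raise algebra_simps)

lemma euler_raise_shift: "euler_raise (c + d) f = euler_raise c f + smult d f"
  by (intro poly_eqI) (simp add: coeff_raise algebra_simps)

lemma euler_raise_0 [simp]: "euler_raise c 0 = 0"
  by (simp add: euler_raise_def)

text \<open>At a zero \<open>z > 0\<close> of \<open>f\<close> the polynomial \<open>- euler_raise c f\<close> equals \<open>- z * f' z\<close>, so the sign
  criterion applies to it for every real \<open>c\<close>. Only positivity of the new zero depends on \<open>c\<close>.\<close>

lemma euler_raise_root_poly:
  assumes "finite S" and pos: "\<forall>z\<in>S. 0 < z"
  shows "degree (- euler_raise c (root_poly S)) = Suc (card S)"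
    and "lead_coeff (- euler_raise c (root_poly S)) = 1"
    and "\<forall>z\<in>S. poly (- euler_raise c (root_poly S)) z * poly (pderiv (root_poly S)) z < 0"
proof -
  let ?f = "root_poly S :: real poly"
  have f: "coeff ?f (card S) = 1" using lead_coeff_root_poly[of S] by (simp add: degree_root_poly)
  have top: "coeff (- euler_raise c ?f) (Suc (card S)) = 1"
    using f by (simp add: coeff_raise coeff_eq_0 degree_root_poly)
  have "degree (- euler_raise c ?f) \<le> Suc (card S)"
    by (intro degree_le) (auto simp: coeff_raise coeff_eq_0 degree_root_poly)
  moreover have "Suc (card S) \<le> degree (- euler_raise c ?f)"
    using top by (intro le_degree) simp
  ultimately show d: "degree (- euler_raise c ?f) = Suc (card S)" by simp
  show "lead_coeff (- euler_raise c ?f) = 1" using d top by simp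
  show "\<forall>z\<in>S. poly (- euler_raise c ?f) z * poly (pderiv ?f) z < 0"
  proof
    fix z assume z: "z \<in> S"
    have "poly (pderiv ?f) z \<noteq> 0"
      using z assms(1) by (simp add: pderiv_root_poly_at_root root_poly_eq_0_iff)
    moreover have "poly (- euler_raise c ?f) z * poly (pderiv ?f) z = - (z * (poly (pderiv ?f) z)\<^sup>2)"
      using root_poly_eq_0_iff[OF assms(1), of z] z by (simp add: euler_raise_def power2_eq_square)
    ultimately show "poly (- euler_raise c ?f) z * poly (pderiv ?f) z < 0"
      using pos z by simp
  qed
qed

lemma zeros_positive_simple_eq_root_poly:
  assumes "zeros_positive_simple f"
  obtains a S where "a \<noteq> 0" "finite S" "\<forall>z\<in>S. 0 < z" "f = smult a (root_poly S)"
proof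
  from assms have r: "zeros_real_simple f" by (simp add: zeros_positive_simple_iff)
  then have f0: "f \<noteq> 0" by (rule zeros_real_simple_imp_ne_0)
  show "f = smult (lead_coeff f) (root_poly {x. poly f x = 0})"
    using zeros_real_simple_eq_root_poly[OF r] .
  show "finite {x. poly f x = 0}" using f0 by (rule poly_roots_finite)
  show "lead_coeff f \<noteq> 0" using f0 by simp
  show "\<forall>z\<in>{x. poly f x = 0}. 0 < z" using assms by (simp add: zeros_positive_simple_iff)
qed

lemma zeros_real_simple_smult:
  "zeros_real_simple f \<Longrightarrow> a \<noteq> 0 \<Longrightarrow> zeros_real_simple (smult a f)"
  by (simp add: zeros_real_simple_def cpoly_smult order_smult)

lemma zeros_positive_simple_smult:
  "zeros_positive_simple f \<Longrightarrow> a \<noteq> 0 \<Longrightarrow> zeros_positive_simple (smult a f)"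
  by (simp add: zeros_positive_simple_def cpoly_smult order_smult)

lemma zeros_real_simple_raise:
  assumes "zeros_positive_simple f"
  shows "zeros_real_simple (euler_raise c f)"
proof -
  obtain a S where S: "a \<noteq> 0" "finite S" "\<forall>z\<in>S. 0 < z" "f = smult a (root_poly S)"
    using zeros_positive_simple_eq_root_poly[OF assms] by metis
  have "zeros_real_simple (- euler_raise c (root_poly S))"
    by (rule interlacing_of_signs(1)[OF S(2) euler_raise_root_poly[OF S(2,3)]])
  then have "zeros_real_simple (smult (- a) (- euler_raise c (root_poly S)))"
    using S by (intro zeros_real_simple_smult) auto
  then show ?thesis by (simp add: S euler_raise_smult)
qed

lemma zeros_positive_simple_raise:
  assumes "zeros_positive_simple f" "c > 0"
  shows "zeros_positive_simple (euler_raise c f)"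
proof -
  obtain a S where S: "a \<noteq> 0" "finite S" "\<forall>z\<in>S. 0 < z" "f = smult a (root_poly S)"
    using zeros_positive_simple_eq_root_poly[OF assms(1)] by metis
  have "poly (root_poly S) 0 * poly (- euler_raise c (root_poly S)) 0 = - (c * (poly (root_poly S) 0)\<^sup>2)"
    by (simp add: euler_raise_def power2_eq_square)
  moreover have "poly (root_poly S) 0 \<noteq> 0" using S by (force simp: root_poly_eq_0_iff)
  ultimately have sg: "poly (root_poly S) 0 * poly (- euler_raise c (root_poly S)) 0 < 0"
    using assms(2) by simp
  have "0 < x" if "poly (- euler_raise c (root_poly S)) x = 0" for x
    by (rule interlacing_of_signs(3)[OF S(2) euler_raise_root_poly[OF S(2,3)] S(3) sg that])
  then show ?thesis
    using zeros_real_simple_raise[OF assms(1)] S by (auto simp: zeros_positive_simple_iff euler_raise_smult)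
qed

lemma zeros_positive_simple_1: "zeros_positive_simple 1"
  by (simp add: zeros_positive_simple_def)

lemma zeros_positive_simple_monic_laguerre:
  assumes "\<alpha> > -1"
  shows "zeros_positive_simple (monic_laguerre \<alpha> n)"
proof (induction n)
  case (Suc n)
  have "zeros_positive_simple (smult (- 1) (euler_raise (real n + \<alpha> + 1) (monic_laguerre \<alpha> n)))"
    using Suc assms by (intro zeros_positive_simple_smult zeros_positive_simple_raise) auto
  then show ?case by (simp add: euler_raise_monic_laguerre)
qed (simp add: zeros_positive_simple_1)

section \<open>The polynomial in the raising operator\<close>

lemma smult_sum_right: "smult a (\<Sum>x\<in>A. f x) = (\<Sum>x\<in>A. smult a (f x))"
  by (induction A rule: infinite_finite_induct) (auto simp: smult_add_right)

text \<open>\<open>P (euler_raise c) f\<close>, evaluated by Horner's scheme; the second argument is the polynomial \<open>P\<close>.\<close>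

definition poly_op :: "real \<Rightarrow> real poly \<Rightarrow> real poly \<Rightarrow> real poly" where
  "poly_op c P f = fold_coeffs (\<lambda>a g. smult a f + euler_raise c g) P 0"

lemma poly_op_0 [simp]: "poly_op c 0 f = 0"
  by (simp add: poly_op_def)

lemma poly_op_pCons [simp]: "poly_op c (pCons a P) f = smult a f + euler_raise c (poly_op c P f)"
  by (cases "a = 0 \<and> P = 0") (auto simp: poly_op_def)

lemma poly_op_1 [simp]: "poly_op c 1 f = f"
  by (simp add: one_pCons)

lemma poly_op_smult: "poly_op c (smult b P) f = smult b (poly_op c P f)"
  by (induction P) (auto simp: euler_raise_smult smult_add_right)

lemma poly_op_add: "poly_op c (P + R) f = poly_op c P f + poly_op c R f"
  by (induction P R rule: poly_induct2) (auto simp: euler_raise_add smult_add_left)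

lemma poly_op_sum: "poly_op c (\<Sum>x\<in>A. P x) f = (\<Sum>x\<in>A. poly_op c (P x) f)"
  by (induction A rule: infinite_finite_induct) (auto simp: poly_op_add)

text \<open>A shift of the operator is a shift of its parameter, so each real zero \<open>\<theta>\<close> of \<open>P\<close> contributes
  one more raising step, with parameter \<open>c - \<theta>\<close>.\<close>

lemma poly_op_linear_factor: "poly_op c ([:b, 1:] * P) f = euler_raise (c + b) (poly_op c P f)"
  by (subst euler_raise_shift) (simp add: poly_op_add poly_op_smult add.commute)

text \<open>The factors of the Pochhammer symbol are exactly the successive raising steps from degree \<open>k\<close>
  to degree \<open>k + s\<close>; this is why \<open>Q\<close> is written in the Pochhammer basis.\<close>

lemma poly_op_pochhammer:
  "poly_op (real k + \<alpha> + 1) (pochhammer [:0, 1:] s) (monic_laguerre \<alpha> k)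
    = smult ((-1) ^ s) (monic_laguerre \<alpha> (k + s))"
proof (induction s)
  case (Suc s)
  have "pochhammer [:0, 1::real:] (Suc s) = [:real s, 1:] * pochhammer [:0, 1:] s"
    by (simp add: pochhammer_Suc of_nat_poly mult.commute)
  moreover have "real k + \<alpha> + 1 + real s = real (k + s) + \<alpha> + 1" by simp
  ultimately show ?case
    by (simp only: poly_op_linear_factor Suc.IH euler_raise_smult euler_raise_monic_laguerre) simp
qed simp

lemma q_poly_eq_poly_op:
  assumes "n \<ge> K"
  shows "q_poly \<alpha> K \<gamma> n
    = smult ((-1) ^ K) (poly_op (real (n - K) + \<alpha> + 1) (Q_poly K \<gamma>) (monic_laguerre \<alpha> (n - K)))"
proof -
  have "smult ((-1) ^ K * ((-1) ^ j * \<gamma> j * (-1) ^ (K - j))) (monic_laguerre \<alpha> (n - K + (K - j)))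
      = smult (\<gamma> j) (monic_laguerre \<alpha> (n - j))" if "j \<le> K" for j
  proof -
    have "(-1 :: real) ^ K = (-1) ^ j * (-1) ^ (K - j)" using that by (simp flip: power_add)
    then have "(-1) ^ K * ((-1) ^ j * \<gamma> j * (-1) ^ (K - j))
        = \<gamma> j * ((-1) ^ j * (-1) ^ j) * ((-1) ^ (K - j) * (-1) ^ (K - j))"
      by (simp only: mult_ac)
    also have "\<dots> = \<gamma> j" by (simp flip: power_add mult_2 add: power_mult)
    finally have "(-1) ^ K * ((-1) ^ j * \<gamma> j * (-1) ^ (K - j)) = \<gamma> j" .
    moreover have "n - K + (K - j) = n - j" using that assms by simp
    ultimately show ?thesis by (simp only:)
  qed
  then show ?thesis
    unfolding q_poly_def Q_poly_def poly_op_sum poly_op_smult poly_op_pochhammer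
    by (simp add: smult_sum_right mult.assoc)
qed

definition linear_factors :: "real multiset \<Rightarrow> real poly" where
  "linear_factors A = (\<Prod>x\<in>#A. [:- x, 1:])"

lemma linear_factors_simps [simp]:
  "linear_factors {#} = 1"
  "linear_factors (add_mset x A) = [:- x, 1:] * linear_factors A"
  by (simp_all add: linear_factors_def)

lemma poly_op_linear_factors_positive:
  assumes "zeros_positive_simple (poly_op c P f)" "\<And>x. x \<in># A \<Longrightarrow> x < c"
  shows "zeros_positive_simple (poly_op c (linear_factors A * P) f)"
  using assms(2)
proof (induction A)
  case (add x A)
  have "poly_op c (linear_factors (add_mset x A) * P) f = euler_raise (c + - x) (poly_op c (linear_factors A * P) f)"
    by (simp only: linear_factors_simps mult.assoc poly_op_linear_factor)
  with add show ?case by (simp add: zeros_positive_simple_raise)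
qed (use assms in simp)

text \<open>Factor out all real zeros; the cofactor carries the nonreal ones.\<close>

lemma linear_factors_proots:
  fixes p :: "real poly"
  assumes "p \<noteq> 0"
  shows "\<exists>r. p = linear_factors (proots p) * r \<and> (\<forall>x. poly r x \<noteq> 0)"
  using assms
proof (induction "degree p" arbitrary: p rule: less_induct)
  case less
  show ?case
  proof (cases "\<exists>x. poly p x = 0")
    case True
    then obtain x where "poly p x = 0" by blast
    then obtain q where p: "p = [:- x, 1:] * q" by (metis poly_eq_0_iff_dvd dvdE)
    with less.prems have q: "q \<noteq> 0" by auto
    have "degree q < degree p" using q unfolding p by (subst degree_mult_eq) auto
    from less.hyps[OF this q] obtain r where r: "q = linear_factors (proots q) * r" "\<forall>x. poly r x \<noteq> 0"
      by blast
    have "proots p = add_mset x (proots q)"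
      using q unfolding p by (subst proots_mult) auto
    then have "p = linear_factors (proots p) * r"
      using r(1) p by (metis linear_factors_simps(2) mult.assoc)
    with r(2) show ?thesis by blast
  next
    case False
    then have "proots p = {#}" using less.prems by (simp add: multiset_eq_iff order_root)
    with False show ?thesis by (intro exI[of _ p]) auto
  qed
qed

lemma lead_coeff_linear_factors: "lead_coeff (linear_factors A) = 1"
  by (induction A) (simp_all only: linear_factors_simps lead_coeff_mult, simp_all)

lemma degree_pochhammer_X: "degree (pochhammer [:0, 1::real:] s) = s"
  and lead_coeff_pochhammer_X: "lead_coeff (pochhammer [:0, 1::real:] s) = 1"
proof -
  have "degree (pochhammer [:0, 1::real:] s) = s \<and> lead_coeff (pochhammer [:0, 1::real:] s) = 1"
  proof (induction s)
    case (Suc s)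
    have *: "[:0, 1::real:] + of_nat s = [:real s, 1:]" by (simp add: of_nat_poly)
    have "pochhammer [:0, 1::real:] s \<noteq> 0" using Suc by force
    then have "degree (pochhammer [:0, 1::real:] (Suc s)) = Suc s"
      unfolding pochhammer_Suc * using Suc by (subst degree_mult_eq) auto
    moreover have "lead_coeff (pochhammer [:0, 1::real:] (Suc s)) = 1"
      unfolding pochhammer_Suc * lead_coeff_mult using Suc by auto
    ultimately show ?case by blast
  qed simp
  then show "degree (pochhammer [:0, 1::real:] s) = s" "lead_coeff (pochhammer [:0, 1::real:] s) = 1" by auto
qed

lemma degree_Q_poly_le:  "degree (Q_poly K \<gamma>) \<le> K"
  unfolding Q_poly_def
  by (intro degree_sum_le) (auto intro!: order.trans[OF degree_smult_le] simp: degree_pochhammer_X)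

lemma coeff_Q_poly_top: "coeff (Q_poly K \<gamma>) K = \<gamma> 0"
proof -
  have "coeff (Q_poly K \<gamma>) K = (\<Sum>j\<le>K. if j = 0 then \<gamma> 0 else 0)"
    unfolding Q_poly_def coeff_sum
  proof (intro sum.cong refl)
    fix j assume "j \<in> {..K}"
    then show "coeff (smult ((-1) ^ j * \<gamma> j) (pochhammer [:0, 1:] (K - j))) K = (if j = 0 then \<gamma> 0 else 0)"
      using lead_coeff_pochhammer_X[of K] by (auto simp: degree_pochhammer_X intro!: coeff_eq_0)
  qed
  then show ?thesis by simp
qed

lemma Q_poly_Suc:
  "Q_poly (Suc K) (case_nat a \<gamma>) = smult a (pochhammer [:0, 1:] (Suc K)) - Q_poly K \<gamma>"
proof -
  have "Q_poly (Suc K) (case_nat a \<gamma>) = smult a (pochhammer [:0, 1:] (Suc K))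
      + (\<Sum>j\<le>K. smult ((-1) ^ Suc j * \<gamma> j) (pochhammer [:0, 1:] (K - j)))"
    unfolding Q_poly_def by (subst sum.atMost_Suc_shift) simp
  also have "(\<Sum>j\<le>K. smult ((-1) ^ Suc j * \<gamma> j) (pochhammer [:0, 1:] (K - j))) = - Q_poly K \<gamma>"
    unfolding Q_poly_def by (simp add: sum_negf)
  finally show ?thesis by simp
qed

text \<open>The Pochhammer symbols have one member in every degree, so they form a basis. Thus every
  operator polynomial comes from some sequence \<open>\<gamma>\<close>.\<close>

lemma ex_Q_poly_eq:
  assumes "degree P \<le> K"
  shows "\<exists>\<gamma>. Q_poly K \<gamma> = P"
  using assms
proof (induction K arbitrary: P)
  case 0
  then obtain a where "P = [:a:]" by (auto elim: degree_eq_zeroE)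
  then show ?case by (intro exI[of _ "\<lambda>_. a"]) (simp add: Q_poly_def)
next
  case (Suc K)
  let ?a = "coeff P (Suc K)"
  let ?R = "smult ?a (pochhammer [:0, 1:] (Suc K)) - P"
  have "degree ?R \<le> K"
  proof (rule degree_le, intro allI impI)
    fix i assume "K < i"
    show "coeff ?R i = 0"
    proof (cases "i = Suc K")
      case True
      then show ?thesis using lead_coeff_pochhammer_X[of "Suc K"] by (simp add: degree_pochhammer_X del: pochhammer_Suc)
    next
      case False
      with \<open>K < i\<close> have "Suc K < i" by simp
      then show ?thesis using Suc.prems by (simp add: coeff_eq_0 degree_pochhammer_X del: pochhammer_Suc)
    qed
  qed
  from Suc.IH[OF this] obtain \<gamma> where "Q_poly K \<gamma> = ?R" by blast
  then show ?case by (intro exI[of _ "case_nat ?a \<gamma>"]) (simp add: Q_poly_Suc)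
qed

section \<open>Asymptotic size of consecutive Laguerre polynomials\<close>

text \<open>For such large \<open>x\<close> the coefficient \<open>x - 2 (m + 1) - \<alpha> - 1\<close> of the recurrence outweighs the
  contribution of the term before last, which is at most \<open>N + \<bar>\<alpha>\<bar>\<close> times the last one.\<close>

lemma monic_laguerre_growth:
  assumes "\<alpha> > -1" "x \<ge> 4 * real N + 2 * \<bar>\<alpha>\<bar> + 1" "m < N"
  shows "poly (monic_laguerre \<alpha> m) x > 0 \<and>
    poly (monic_laguerre \<alpha> (Suc m)) x \<ge> real N * poly (monic_laguerre \<alpha> m) x"
  using assms(3)
proof (induction m)
  case 0
  then show ?case using assms(1,2) monic_laguerre_1[of \<alpha> x] by simp
next
  case (Suc m)
  define a b where "a = poly (monic_laguerre \<alpha> m) x" and "b = poly (monic_laguerre \<alpha> (Suc m)) x"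
  have a: "a > 0" and ab: "real N * a \<le> b" using Suc by (simp_all add: a_def b_def)
  have "N > 0" using Suc by simp
  then have b: "b > 0" using a ab by (smt (verit) mult_pos_pos of_nat_0_less_iff)
  have "real (Suc m) * (real (Suc m) + \<alpha>) \<le> real N * (real N + \<bar>\<alpha>\<bar>)"
    using Suc.prems assms(1) by (intro mult_mono) auto
  then have "real (Suc m) * (real (Suc m) + \<alpha>) * a \<le> (real N * (real N + \<bar>\<alpha>\<bar>)) * a"
    using a by (intro mult_right_mono) auto
  also have "\<dots> = (real N + \<bar>\<alpha>\<bar>) * (real N * a)" by simp
  also have "\<dots> \<le> (real N + \<bar>\<alpha>\<bar>) * b" using ab by (intro mult_left_mono) auto
  finally have "poly (monic_laguerre \<alpha> (Suc (Suc m))) x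
      \<ge> (x - 2 * real (Suc m) - \<alpha> - 1) * b - (real N + \<bar>\<alpha>\<bar>) * b"
    by (simp only: monic_laguerre_rec a_def[symmetric] b_def[symmetric])
  also have "(x - 2 * real (Suc m) - \<alpha> - 1) * b - (real N + \<bar>\<alpha>\<bar>) * b
      = (x - 2 * real (Suc m) - \<alpha> - 1 - (real N + \<bar>\<alpha>\<bar>)) * b" by (simp add: left_diff_distrib)
  finally have 1: "poly (monic_laguerre \<alpha> (Suc (Suc m))) x
      \<ge> (x - 2 * real (Suc m) - \<alpha> - 1 - (real N + \<bar>\<alpha>\<bar>)) * b" .
  have "real N * b \<le> (x - 2 * real (Suc m) - \<alpha> - 1 - (real N + \<bar>\<alpha>\<bar>)) * b"
    using b Suc.prems assms(2) by (intro mult_right_mono) auto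
  from order.trans[OF this 1] b show ?case unfolding b_def by blast
qed

lemma monic_laguerre_bound_right:
  assumes "\<alpha> > -1" "real n \<ge> 4 * \<bar>\<alpha>\<bar> + 2 * real K + 4" "x \<ge> 5 * real n" "j \<le> K"
  shows "\<bar>poly (monic_laguerre \<alpha> (n - j)) x\<bar> \<le> (48 / real n) ^ j * \<bar>poly (monic_laguerre \<alpha> n) x\<bar>"
  using assms(4)
proof (induction j)
  case (Suc j)
  have x: "x \<ge> 4 * real n + 2 * \<bar>\<alpha>\<bar> + 1" using assms(2,3) by linarith
  have n: "real n > 0" using assms(2) by linarith
  have "real j < real n" using Suc.prems assms(2) by linarith
  then have j: "j < n" by simp
  then have e: "n - j = Suc (n - Suc j)" by simp
  have "n - Suc j < n" using j by simp
  from monic_laguerre_growth[OF assms(1) x this]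
  have g: "real n * \<bar>poly (monic_laguerre \<alpha> (n - Suc j)) x\<bar> \<le> \<bar>poly (monic_laguerre \<alpha> (n - j)) x\<bar>"
    using e by (auto intro: order_trans[OF _ abs_ge_self])
  have "\<bar>poly (monic_laguerre \<alpha> (n - Suc j)) x\<bar> \<le> \<bar>poly (monic_laguerre \<alpha> (n - j)) x\<bar> / real n"
    using g n by (simp add: field_simps)
  also have "\<dots> \<le> (48 / real n) * \<bar>poly (monic_laguerre \<alpha> (n - j)) x\<bar>"
    using n by (simp add: divide_simps)
  also have "\<dots> \<le> (48 / real n) * ((48 / real n) ^ j * \<bar>poly (monic_laguerre \<alpha> n) x\<bar>)"
    using Suc n by (intro mult_left_mono) auto
  finally show ?case by simp
qed simp

text \<open>On \<open>[0, 5 n]\<close> the recurrence is run downwards. With \<open>r = D / n\<close> a step multiplies the bound by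
  at most \<open>r\<close> provided that \<open>5 D + 1 \<le> D\<^sup>2 / 8\<close>, since the coefficients of the recurrence are at
  most \<open>5 n\<close> and \<open>1\<close>, and the divisor \<open>m (m + \<alpha>)\<close> is at least \<open>n\<^sup>2 / 8\<close>; \<open>D = 48\<close> satisfies this.
  The number \<open>E\<close> bounds the two starting values, the second one after scaling by \<open>n\<close>.\<close>

lemma monic_laguerre_bound_left:
  assumes "\<alpha> > -1" "real n \<ge> 4 * \<bar>\<alpha>\<bar> + 2 * real K + 4" "0 \<le> x" "x \<le> 5 * real n"
    and E: "\<bar>poly (monic_laguerre \<alpha> n) x\<bar> \<le> E" "real n * \<bar>poly (monic_laguerre \<alpha> (n - 1)) x\<bar> \<le> E"
    and "j \<le> K"
  shows "\<bar>poly (monic_laguerre \<alpha> (n - j)) x\<bar> \<le> (48 / real n) ^ j * E"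
  using \<open>j \<le> K\<close>
proof (induction j rule: induct_nat_012)
  case 1
  have "real n > 0" using assms(2) by linarith
  have "E \<ge> 0" using E(1) by linarith
  then show ?case using E(2) \<open>real n > 0\<close> by (simp add: field_simps)
next
  case (ge2 j)
  have n0: "real n > 0" using assms(2) by linarith
  have E0: "E \<ge> 0" using E(1) by linarith
  define r where "r = 48 / real n"
  have r: "r > 0" "real n * r = 48" using n0 by (simp_all add: r_def)
  have "real (Suc (Suc j)) \<le> real n / 2" using ge2.prems assms(2) by linarith
  then have "real (Suc (Suc j)) < real n" using n0 by linarith
  then have "Suc (Suc j) < n" by linarith
  then obtain p where p: "n = p + Suc (Suc j)" by (metis add.commute less_imp_add_positive)
  define m where "m = real (Suc p)"
  have m: "m \<ge> real n / 2" "m \<le> real n" using ge2.prems assms(2) p by (auto simp: m_def)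
  have e: "n - j = Suc (Suc p)" "n - Suc j = Suc p" "n - Suc (Suc j) = p" using p by auto
  define u v w where "u = poly (monic_laguerre \<alpha> p) x" and "v = poly (monic_laguerre \<alpha> (Suc p)) x"
    and "w = poly (monic_laguerre \<alpha> (Suc (Suc p))) x"
  have rec: "m * (m + \<alpha>) * u = (x - 2 * m - \<alpha> - 1) * v - w"
    using monic_laguerre_rec[of \<alpha> p x] by (simp only: u_def v_def w_def m_def)
  have v: "\<bar>v\<bar> \<le> r * r ^ j * E" and w: "\<bar>w\<bar> \<le> r ^ j * E"
    using ge2 e by (simp_all add: v_def w_def r_def)
  have c: "\<bar>x - 2 * m - \<alpha> - 1\<bar> \<le> 5 * real n" using m assms(1-4) by linarith
  have "m + \<alpha> \<ge> real n / 4" using m assms(2) by linarith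
  then have "(real n / 2) * (real n / 4) \<le> m * (m + \<alpha>)" using m n0 by (intro mult_mono) auto
  then have "(real n)\<^sup>2 / 8 * \<bar>u\<bar> \<le> m * (m + \<alpha>) * \<bar>u\<bar>"
    by (intro mult_right_mono) (auto simp: power2_eq_square)
  also have "\<dots> = \<bar>(x - 2 * m - \<alpha> - 1) * v - w\<bar>"
    using rec \<open>m + \<alpha> \<ge> real n / 4\<close> m n0 by (simp flip: rec add: abs_mult)
  also have "\<dots> \<le> \<bar>x - 2 * m - \<alpha> - 1\<bar> * \<bar>v\<bar> + \<bar>w\<bar>"
    by (metis abs_mult abs_triangle_ineq4)
  also have "\<dots> \<le> (5 * real n) * (r * r ^ j * E) + r ^ j * E"
    using c v w n0 by (intro add_mono mult_mono) auto
  also have "\<dots> = (5 * (real n * r) + 1) * (r ^ j * E)" by (simp add: algebra_simps)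
  also have "\<dots> \<le> (real n * r)\<^sup>2 / 8 * (r ^ j * E)"
    unfolding r(2) using r(1) E0 by (intro mult_right_mono) auto
  also have "\<dots> = (real n)\<^sup>2 / 8 * (r ^ Suc (Suc j) * E)" by (simp add: power2_eq_square)
  finally show ?case using n0 unfolding e(3) u_def[symmetric] r_def[symmetric] by simp
qed (use E in simp)

section \<open>Zeros for large degree\<close>

definition weight :: "nat \<Rightarrow> (nat \<Rightarrow> real) \<Rightarrow> real" where
  "weight K \<gamma> = (\<Sum>j=1..K. \<bar>\<gamma> j\<bar> * 48 ^ j)"

lemma weight_nonneg: "weight K \<gamma> \<ge> 0"
  by (auto simp: weight_def intro!: sum_nonneg)

text \<open>The decay \<open>(48 / n) ^ j\<close> makes the sum of the terms with \<open>j \<ge> 1\<close> smaller than \<open>E\<close> by a factor of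
  order \<open>1 / n\<close> in \<open>q\<^sub>n\<close>; for the tail of
  the next polynomial \<open>q\<^sub>n\<^sub>+\<^sub>1\<close> the shifted index loses this factor.\<close>

lemma tail_bounds:
  assumes "n \<ge> 48" "E \<ge> 0" and H: "\<And>j. j \<le> K \<Longrightarrow> \<bar>h (n - j)\<bar> \<le> (48 / real n) ^ j * E"
  shows "\<bar>\<Sum>j=1..K. \<gamma> j * h (n - j)\<bar> \<le> weight K \<gamma> / real n * E"
    and "\<bar>\<Sum>j=1..K. \<gamma> j * h (Suc n - j)\<bar> \<le> weight K \<gamma> * E"
proof -
  have n: "real n \<ge> 48" using assms(1) by simp
  have "\<bar>\<Sum>j=1..K. \<gamma> j * h (n - j)\<bar> \<le> (\<Sum>j=1..K. \<bar>\<gamma> j\<bar> * 48 ^ j / real n * E)"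
  proof (rule sum_norm_le[where 'a = real, simplified real_norm_def])
    fix j assume "j \<in> {1..K}"
    then obtain i where j: "j = Suc i" "j \<le> K" by (cases j) auto
    have "(48 / real n) ^ j \<le> 48 ^ j / real n"
    proof -
      have "(48 / real n) ^ i \<le> 48 ^ i" using n by (intro power_mono) (auto simp: field_simps)
      then show ?thesis using n by (simp add: j field_simps)
    qed
    then have "\<bar>h (n - j)\<bar> \<le> 48 ^ j / real n * E"
      using H[OF j(2)] assms(2) by (meson mult_right_mono order_trans)
    then have "\<bar>\<gamma> j\<bar> * \<bar>h (n - j)\<bar> \<le> \<bar>\<gamma> j\<bar> * (48 ^ j / real n * E)" by (intro mult_left_mono) auto
    then show "\<bar>\<gamma> j * h (n - j)\<bar> \<le> \<bar>\<gamma> j\<bar> * 48 ^ j / real n * E" by (simp add: abs_mult)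
  qed
  then show "\<bar>\<Sum>j=1..K. \<gamma> j * h (n - j)\<bar> \<le> weight K \<gamma> / real n * E"
    by (simp add: weight_def sum_divide_distrib sum_distrib_right)
  have "\<bar>\<Sum>j=1..K. \<gamma> j * h (Suc n - j)\<bar> \<le> (\<Sum>j=1..K. \<bar>\<gamma> j\<bar> * 48 ^ j * E)"
  proof (rule sum_norm_le[where 'a = real, simplified real_norm_def])
    fix j assume "j \<in> {1..K}"
    then obtain i where j: "j = Suc i" "i \<le> K" by (cases j) auto
    have "(48 / real n) ^ i \<le> 1" using n by (intro power_le_one) auto
    also have "1 \<le> (48 :: real) ^ j" by simp
    finally have "\<bar>h (n - i)\<bar> \<le> 48 ^ j * E"
      using H[OF j(2)] assms(2) by (meson mult_right_mono order_trans)
    then have "\<bar>\<gamma> j\<bar> * \<bar>h (n - i)\<bar> \<le> \<bar>\<gamma> j\<bar> * (48 ^ j * E)" by (intro mult_left_mono) auto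
    then show "\<bar>\<gamma> j * h (Suc n - j)\<bar> \<le> \<bar>\<gamma> j\<bar> * 48 ^ j * E" by (simp add: j abs_mult mult.assoc)
  qed
  then show "\<bar>\<Sum>j=1..K. \<gamma> j * h (Suc n - j)\<bar> \<le> weight K \<gamma> * E"
    by (simp add: weight_def sum_distrib_right)
qed

text \<open>A degree from which the tail of \<open>q\<^sub>n\<close> is dominated. At a zero of \<open>q\<^sub>n\<close> the
  error terms of \<open>q\<^sub>n\<^sub>+\<^sub>1\<close> total at most \<open>6 n\<close> times the weight and the main term is at least
  \<open>3 n\<^sup>2 / 4\<close>, both relative to the modulus of the Laguerre polynomial of degree \<open>n - 1\<close>; hence a
  factor of \<open>8\<close> or more in front of the weight.\<close>

definition large_degree :: "real \<Rightarrow> nat \<Rightarrow> (nat \<Rightarrow> real) \<Rightarrow> nat \<Rightarrow> bool" where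
  "large_degree \<alpha> K \<gamma> n \<longleftrightarrow> real n \<ge> 4 * \<bar>\<alpha>\<bar> + 2 * real K + 48 \<and> real n > 9 * weight K \<gamma>"

lemma large_degreeD:
  assumes "large_degree \<alpha> K \<gamma> n"
  shows "real n \<ge> 4 * \<bar>\<alpha>\<bar> + 2 * real K + 4" "real n > 9 * weight K \<gamma>" "n \<ge> 48" "real n > 0" "K < n"
proof -
  show *: "real n \<ge> 4 * \<bar>\<alpha>\<bar> + 2 * real K + 4" "real n > 9 * weight K \<gamma>"
    using assms by (auto simp: large_degree_def)
  have "real n \<ge> 48" "real K < real n" using assms by (auto simp: large_degree_def)
  then show "n \<ge> 48" "real n > 0" "K < n" by auto
qed

lemma poly_q_poly:
  assumes "\<gamma> 0 = 1"
  shows "poly (q_poly \<alpha> K \<gamma> n) x = poly (monic_laguerre \<alpha> n) x + (\<Sum>j=1..K. \<gamma> j * poly (monic_laguerre \<alpha> (n - j)) x)"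
proof -
  have "{..K} = insert 0 {1..K}" by auto
  then show ?thesis using assms by (simp add: q_poly_def poly_sum)
qed

lemma q_poly_monic:
  assumes "\<gamma> 0 = 1" "n > 0"
  shows "degree (q_poly \<alpha> K \<gamma> n) = n" "lead_coeff (q_poly \<alpha> K \<gamma> n) = 1"
proof -
  have c: "coeff (q_poly \<alpha> K \<gamma> n) i = coeff (monic_laguerre \<alpha> n) i" if "i \<ge> n" for i
  proof -
    have "{..K} = insert 0 {1..K}" by auto
    moreover have "(\<Sum>j=1..K. \<gamma> j * coeff (monic_laguerre \<alpha> (n - j)) i) = 0"
      using that assms(2) by (intro sum.neutral) (auto intro!: coeff_eq_0)
    ultimately show ?thesis using assms(1) by (simp add: q_poly_def coeff_sum)
  qed
  then show "degree (q_poly \<alpha> K \<gamma> n) = n"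
    by (intro antisym degree_le le_degree) (auto simp: coeff_eq_0)
  with c show "lead_coeff (q_poly \<alpha> K \<gamma> n) = 1" by simp
qed

text \<open>Wherever \<open>L\<^sub>n\<^sub>-\<^sub>1\<close> is at most \<open>2 / n\<close> times as large as \<open>L\<^sub>n\<close>, the leading term decides the sign
  of \<open>q\<^sub>n\<close>. This covers the zeros of \<open>L\<^sub>n\<^sub>-\<^sub>1\<close>, the origin, and everything beyond \<open>5 n\<close>.\<close>

lemma q_poly_sign:
  assumes "\<alpha> > -1" "\<gamma> 0 = 1" "large_degree \<alpha> K \<gamma> n" "poly (monic_laguerre \<alpha> n) x \<noteq> 0"
    and x: "x \<ge> 5 * real n \<or> 0 \<le> x \<and> real n * \<bar>poly (monic_laguerre \<alpha> (n - 1)) x\<bar> \<le> 2 * \<bar>poly (monic_laguerre \<alpha> n) x\<bar>"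
  shows "poly (q_poly \<alpha> K \<gamma> n) x * poly (monic_laguerre \<alpha> n) x > 0"
proof -
  note L = large_degreeD[OF assms(3)]
  define e where "e = \<bar>poly (monic_laguerre \<alpha> n) x\<bar>"
  have e: "e > 0" using assms(4) by (simp add: e_def)
  have "\<bar>poly (monic_laguerre \<alpha> (n - j)) x\<bar> \<le> (48 / real n) ^ j * (2 * e)" if "j \<le> K" for j
  proof (cases "x \<ge> 5 * real n")
    case True
    from monic_laguerre_bound_right[OF assms(1) L(1) True that]
    have "\<bar>poly (monic_laguerre \<alpha> (n - j)) x\<bar> \<le> (48 / real n) ^ j * e" by (simp add: e_def)
    also have "\<dots> \<le> (48 / real n) ^ j * (2 * e)" using e by (intro mult_left_mono) auto
    finally show ?thesis .
  next
    case False
    with x show ?thesis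
      by (intro monic_laguerre_bound_left[OF assms(1) L(1)] that) (auto simp: e_def)
  qed
  from tail_bounds(1)[OF L(3) _ this]
  have "\<bar>\<Sum>j=1..K. \<gamma> j * poly (monic_laguerre \<alpha> (n - j)) x\<bar> \<le> weight K \<gamma> / real n * (2 * e)"
    using e by simp
  also have "\<dots> < e"
    using L(2,4) e weight_nonneg[of K \<gamma>] by (simp add: field_simps)
  finally have "\<bar>\<Sum>j=1..K. \<gamma> j * poly (monic_laguerre \<alpha> (n - j)) x\<bar> < e" .
  then show ?thesis unfolding poly_q_poly[where \<gamma> = \<gamma>, OF assms(2)] e_def
    by (smt (verit) assms(4) mult_pos_pos mult_neg_neg)
qed

text \<open>At the zeros of \<open>L\<^sub>n\<^sub>-\<^sub>1\<close> and at the origin \<open>q\<^sub>n\<close> has the sign of \<open>L\<^sub>n\<close>, for which the sign criterion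
  relative to \<open>L\<^sub>n\<^sub>-\<^sub>1\<close> holds because \<open>L\<^sub>n\<close> arises from it by a raising step. Here \<open>L\<^sub>n\<close> stands for the
  monic Laguerre polynomial.\<close>

lemma q_poly_laguerre_signs:
  assumes "\<alpha> > -1" "\<gamma> 0 = 1" "large_degree \<alpha> K \<gamma> n"
  shows "zeros_positive_simple (q_poly \<alpha> K \<gamma> n)"
    and "\<And>w. poly (q_poly \<alpha> K \<gamma> n) w = 0 \<Longrightarrow>
      poly (monic_laguerre \<alpha> (n - 1)) w * poly (pderiv (q_poly \<alpha> K \<gamma> n)) w > 0"
proof -
  note L = large_degreeD[OF assms(3)]
  obtain p where n: "n = Suc p" using L(3) by (cases n) auto
  define S where "S = {x. poly (monic_laguerre \<alpha> p) x = 0}"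
  let ?q = "q_poly \<alpha> K \<gamma> n"
  have zps: "zeros_positive_simple (monic_laguerre \<alpha> p)"
    using assms(1) by (rule zeros_positive_simple_monic_laguerre)
  then have zrs: "zeros_real_simple (monic_laguerre \<alpha> p)" by (simp add: zeros_positive_simple_iff)
  have f: "monic_laguerre \<alpha> p = root_poly S"
    using zeros_real_simple_eq_root_poly[OF zrs] by (simp add: S_def)
  have fin: "finite S"
    unfolding S_def by (rule poly_roots_finite[OF zeros_real_simple_imp_ne_0[OF zrs]])
  have pos: "\<forall>z\<in>S. 0 < z" using zps by (simp add: S_def zeros_positive_simple_iff)
  have card: "card S = p" using degree_root_poly[of S] f by (metis degree_monic_laguerre)
  have deg: "degree ?q = Suc (card S)" "lead_coeff ?q = 1"
    using q_poly_monic[of \<gamma> n \<alpha> K] assms(2) card n by auto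
  have up: "- euler_raise (real p + \<alpha> + 1) (root_poly S) = monic_laguerre \<alpha> n"
    using euler_raise_monic_laguerre[of p \<alpha>] by (simp add: f n)
  have signs: "\<forall>z\<in>S. poly ?q z * poly (pderiv (root_poly S)) z < 0"
  proof
    fix z assume z: "z \<in> S"
    then have "poly (monic_laguerre \<alpha> n) z * poly (pderiv (root_poly S)) z < 0"
      using euler_raise_root_poly(3)[OF fin pos, of "real p + \<alpha> + 1"] unfolding up by blast
    moreover from this have "poly ?q z * poly (monic_laguerre \<alpha> n) z > 0"
      using z pos by (intro q_poly_sign[OF assms]) (auto simp: n S_def)
    ultimately show "poly ?q z * poly (pderiv (root_poly S)) z < 0"
      by (smt (verit) mult_less_0_iff zero_less_mult_iff)
  qed
  have sg: "poly (root_poly S) 0 * poly ?q 0 < 0"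
  proof -
    have a0: "poly (root_poly S) 0 \<noteq> 0" using pos fin by (auto simp: root_poly_eq_0_iff)
    have l0: "poly (monic_laguerre \<alpha> n) 0 = - (real n + \<alpha>) * poly (root_poly S) 0"
      using monic_laguerre_at_0[of \<alpha> p] by (simp add: n f add_ac)
    have np: "n - Suc 0 = p" by (simp add: n)
    have na: "real n + \<alpha> \<ge> real n / 2" "real n + \<alpha> > 0" using L(1) by linarith+
    have "real n * \<bar>poly (root_poly S) 0\<bar> \<le> (2 * (real n + \<alpha>)) * \<bar>poly (root_poly S) 0\<bar>"
      using na by (intro mult_right_mono) auto
    then have "poly ?q 0 * poly (monic_laguerre \<alpha> n) 0 > 0"
      using a0 na by (intro q_poly_sign[OF assms]) (auto simp: l0 np f abs_mult)
    then have "(real n + \<alpha>) * (poly (root_poly S) 0 * poly ?q 0) < 0"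
      unfolding l0 by (simp add: algebra_simps)
    with na show ?thesis by (simp add: mult_less_0_iff)
  qed
  have "zeros_real_simple ?q" by (rule interlacing_of_signs(1)[OF fin deg signs])
  moreover have "0 < x" if "poly ?q x = 0" for x
    by (rule interlacing_of_signs(3)[OF fin deg signs pos sg that])
  ultimately show "zeros_positive_simple ?q" by (simp add: zeros_positive_simple_iff)
  show "poly (monic_laguerre \<alpha> (n - 1)) w * poly (pderiv ?q) w > 0" if "poly ?q w = 0" for w
    using interlacing_of_signs(2)[OF fin deg signs that] by (simp add: n f)
qed

text \<open>At a zero \<open>w\<close> of \<open>q\<^sub>n\<close> the tail estimate bounds \<open>L\<^sub>n w\<close> by a constant times \<open>L\<^sub>n\<^sub>-\<^sub>1 w\<close>. Then the
  term \<open>- n (n + \<alpha>) L\<^sub>n\<^sub>-\<^sub>1\<close> of the recurrence for \<open>L\<^sub>n\<^sub>+\<^sub>1\<close> dominates \<open>q\<^sub>n\<^sub>+\<^sub>1 w\<close>, whose sign is therefore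
  opposite to that of \<open>L\<^sub>n\<^sub>-\<^sub>1 w\<close>, hence opposite to that of \<open>q\<^sub>n'\<close> at \<open>w\<close>.\<close>

lemma q_poly_Suc_interlaces:
  assumes "\<alpha> > -1" "\<gamma> 0 = 1" "large_degree \<alpha> K \<gamma> n"
  shows "interlaces {x. poly (q_poly \<alpha> K \<gamma> (Suc n)) x = 0} {x. poly (q_poly \<alpha> K \<gamma> n) x = 0}"
proof -
  note L = large_degreeD[OF assms(3)]
  let ?q = "q_poly \<alpha> K \<gamma> n" and ?r = "q_poly \<alpha> K \<gamma> (Suc n)"
  define S where "S = {x. poly ?q x = 0}"
  obtain p where n: "n = Suc p" using L(3) by (cases n) auto
  have zps: "zeros_positive_simple ?q" using q_poly_laguerre_signs(1)[OF assms] .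
  then have zrs: "zeros_real_simple ?q" by (simp add: zeros_positive_simple_iff)
  have q: "degree ?q = n" "lead_coeff ?q = 1" using q_poly_monic[of \<gamma> n] assms(2) L(3) by auto
  have r: "degree ?r = Suc n" "lead_coeff ?r = 1" using q_poly_monic[of \<gamma> "Suc n"] assms(2) by auto
  have f: "?q = root_poly S"
    using zeros_real_simple_eq_root_poly[OF zrs] unfolding q(2) by (simp add: S_def)
  have fin: "finite S"
    unfolding S_def by (rule poly_roots_finite[OF zeros_real_simple_imp_ne_0[OF zrs]])
  have card: "card S = n" using degree_root_poly[of S] f q(1) by metis
  have "poly ?r w * poly (pderiv (root_poly S)) w < 0" if w: "w \<in> S" for w
  proof -
    define G where "G = weight K \<gamma>"
    have G: "G \<ge> 0" "real n > 9 * G" using weight_nonneg L(2) by (auto simp: G_def)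
    have root: "poly ?q w = 0" using w by (simp add: S_def)
    have w0: "w > 0" using root zps by (simp add: zeros_positive_simple_iff)
    have sgn: "poly (monic_laguerre \<alpha> p) w * poly (pderiv ?q) w > 0"
      using q_poly_laguerre_signs(2)[OF assms root] by (simp add: n)
    define a b where "a = poly (monic_laguerre \<alpha> p) w" and "b = poly (monic_laguerre \<alpha> n) w"
    have a0: "a \<noteq> 0" using sgn by (auto simp: a_def)
    have w5: "w \<le> 5 * real n"
    proof (rule ccontr)
      assume c: "\<not> w \<le> 5 * real n"
      then have "4 * real (Suc n) + 2 * \<bar>\<alpha>\<bar> + 1 \<le> w" using L(1,3) by simp
      from monic_laguerre_growth[OF assms(1) this, of n]
      have "poly (monic_laguerre \<alpha> n) w \<noteq> 0" by simp
      from q_poly_sign[OF assms this] c root show False by simp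
    qed
    define E where "E = max \<bar>b\<bar> (real n * \<bar>a\<bar>)"
    have E0: "E > 0" using a0 L(4) by (simp add: E_def less_max_iff_disj)
    have H: "\<bar>poly (monic_laguerre \<alpha> (n - j)) w\<bar> \<le> (48 / real n) ^ j * E" if "j \<le> K" for j
      using w0 w5 by (intro monic_laguerre_bound_left[OF assms(1) L(1)] that) (auto simp: E_def a_def b_def n)
    have "\<bar>b\<bar> = \<bar>\<Sum>j=1..K. \<gamma> j * poly (monic_laguerre \<alpha> (n - j)) w\<bar>"
      using root unfolding poly_q_poly[where \<gamma> = \<gamma>, OF assms(2)] b_def by linarith
    also have "\<dots> \<le> G / real n * E"
      unfolding G_def by (rule tail_bounds(1)[where h = "\<lambda>i. poly (monic_laguerre \<alpha> i) w", OF L(3) _ H]) (use E0 in auto)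
    finally have bE: "\<bar>b\<bar> \<le> G / real n * E" .
    \<comment> \<open>So the maximum \<open>E\<close> is not attained by \<open>\<bar>b\<bar>\<close>.\<close>
    also have "\<dots> < E" using G E0 L(4) by (simp add: field_simps)
    finally have E: "E = real n * \<bar>a\<bar>" by (simp add: E_def max_def split: if_splits)
    have bG: "\<bar>b\<bar> \<le> G * \<bar>a\<bar>" using bE L(4) unfolding E by simp
    define t where "t = (\<Sum>j=1..K. \<gamma> j * poly (monic_laguerre \<alpha> (Suc n - j)) w)"
    have t: "\<bar>t\<bar> \<le> G * E"
      unfolding G_def t_def by (rule tail_bounds(2)[where h = "\<lambda>i. poly (monic_laguerre \<alpha> i) w", OF L(3) _ H]) (use E0 in auto)
    define c where "c = w - 2 * real n - \<alpha> - 1"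
    have c: "\<bar>c\<bar> \<le> 5 * real n" using w0 w5 assms(1) L(1) by (auto simp: c_def)
    have rw: "poly ?r w = c * b - real n * (real n + \<alpha>) * a + t"
      using monic_laguerre_rec[of \<alpha> p w]
      unfolding poly_q_poly[where \<gamma> = \<gamma>, OF assms(2)] t_def a_def b_def c_def n[symmetric] by simp
    have "\<bar>c * b + t\<bar> \<le> \<bar>c\<bar> * \<bar>b\<bar> + \<bar>t\<bar>" by (metis abs_mult abs_triangle_ineq)
    also have "\<dots> \<le> (5 * real n) * (G * \<bar>a\<bar>) + G * (real n * \<bar>a\<bar>)"
      using c bG t G L(4) unfolding E by (intro add_mono mult_mono) auto
    also have "\<dots> = (6 * G) * (real n * \<bar>a\<bar>)" by simp
    also have "\<dots> < (real n + \<alpha>) * (real n * \<bar>a\<bar>)"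
      using G L(1,4) a0 by (intro mult_strict_right_mono) auto
    also have "\<dots> = \<bar>real n * (real n + \<alpha>) * a\<bar>"
      using L(1,4) by (simp add: abs_mult)
    finally have ct: "\<bar>c * b + t\<bar> < \<bar>real n * (real n + \<alpha>) * a\<bar>" .
    have "real n * (real n + \<alpha>) > 0" using L(1,4) by auto
    with ct have "poly ?r w * a < 0"
      unfolding rw by (smt (verit) mult_less_0_iff zero_less_mult_iff)
    with sgn show ?thesis
      unfolding f a_def[symmetric] by (smt (verit) mult_less_0_iff zero_less_mult_iff)
  qed
  then have "interlaces {x. poly ?r x = 0} S"
    using card L(3) r by (intro interlacing_of_signs(4)[OF fin]) auto
  then show ?thesis by (simp add: S_def)
qed

lemma eventually_large_degree: "eventually (large_degree \<alpha> K \<gamma>) sequentially"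
proof -
  have "eventually (\<lambda>n. max (4 * \<bar>\<alpha>\<bar> + 2 * real K + 48) (9 * weight K \<gamma>) < real n) sequentially"
    using filterlim_real_sequentially unfolding filterlim_at_top_dense by blast
  then show ?thesis by (rule eventually_mono) (auto simp: large_degree_def)
qed

section \<open>Reduction to the zeros of the polynomial Q\<close>

lemma set_thetas: "set (thetas \<alpha> K \<gamma>) = {x \<in> set_mset (proots (Q_poly K \<gamma>)). \<alpha> + 1 \<le> x}"
  by (auto simp: thetas_def)

text \<open>The floor in \<open>n_bound\<close> is exactly what makes the parameter of the raising step that belongs to
  \<open>\<theta>\<close> positive: \<open>\<lfloor>\<theta> - \<alpha> + K\<rfloor> \<le> n\<close> says \<open>n - K + \<alpha> + 1 - \<theta> > 0\<close>.\<close>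

lemma n_bound_ge:
  assumes "int n \<ge> n_bound \<alpha> K \<gamma> l"
  shows "n \<ge> K"
    and "\<And>i. i < length (thetas \<alpha> K \<gamma>) - l \<Longrightarrow> thetas \<alpha> K \<gamma> ! i < real (n - K) + \<alpha> + 1"
proof -
  let ?A = "{int K} \<union> (\<lambda>i. \<lfloor>thetas \<alpha> K \<gamma> ! (i - 1) - \<alpha> + real K\<rfloor>) ` {1..length (thetas \<alpha> K \<gamma>) - l}"
  have le: "y \<le> int n" if "y \<in> ?A" for y
    using assms that unfolding n_bound_def by (meson Max_ge finite.intros finite_UnI finite_imageI finite_atLeastAtMost order_trans)
  show K: "n \<ge> K" using le[of "int K"] by simp
  fix i assume "i < length (thetas \<alpha> K \<gamma>) - l"
  then have "\<lfloor>thetas \<alpha> K \<gamma> ! (Suc i - 1) - \<alpha> + real K\<rfloor> \<le> int n"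
    by (intro le UnI2 imageI) auto
  then have "thetas \<alpha> K \<gamma> ! i - \<alpha> + real K < real n + 1" by (simp only: floor_le_iff) simp
  then show "thetas \<alpha> K \<gamma> ! i < real (n - K) + \<alpha> + 1" using K by (simp add: of_nat_diff)
qed

lemma Q_poly_monic:
  assumes "\<gamma> 0 = 1"
  shows "degree (Q_poly K \<gamma>) = K" "lead_coeff (Q_poly K \<gamma>) = 1" "Q_poly K \<gamma> \<noteq> 0"
proof -
  have "coeff (Q_poly K \<gamma>) K = 1" by (simp add: coeff_Q_poly_top assms)
  then show d: "degree (Q_poly K \<gamma>) = K"
    by (intro antisym degree_Q_poly_le le_degree) simp
  then show "lead_coeff (Q_poly K \<gamma>) = 1" using \<open>coeff (Q_poly K \<gamma>) K = 1\<close> by simp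
  then show "Q_poly K \<gamma> \<noteq> 0" by auto
qed

lemma only_real_zeros_imp_linear_factors:
  assumes "only_real_zeros p" "lead_coeff p = 1"
  shows "p = linear_factors (proots p)"
proof -
  from assms have "p \<noteq> 0" by auto
  from linear_factors_proots[OF this]
  obtain r where r: "p = linear_factors (proots p) * r" "\<forall>x. poly r x \<noteq> 0" by blast
  have "degree r = 0"
  proof (rule ccontr)
    assume "degree r \<noteq> 0"
    then obtain z where z: "poly (cpoly r) z = 0"
      using alg_closed_imp_poly_has_root[of "cpoly r"] by (auto simp: degree_map_poly)
    then have "poly (cpoly p) z = 0" by (subst r(1)) (simp add: cpoly_mult)
    with assms(1) obtain x where "z = complex_of_real x" unfolding only_real_zeros_def by (meson Reals_cases)
    with z r(2) show False by (simp add: poly_cpoly_of_real)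
  qed
  moreover have "lead_coeff r = 1"
    using assms(2) r(1) lead_coeff_linear_factors[of "proots p"] by (metis lead_coeff_mult mult_1)
  ultimately have "r = 1" by (metis degree_eq_zeroE lead_coeff_pCons(2) one_pCons degree_pCons_0 coeff_pCons_0)
  with r(1) show ?thesis by simp
qed

lemma zeros_positive_simple_q_poly:
  assumes "\<alpha> > -1" "\<gamma> 0 = 1" "only_real_zeros (Q_poly K \<gamma>)" "int n \<ge> n_bound \<alpha> K \<gamma> 0"
  shows "zeros_positive_simple (q_poly \<alpha> K \<gamma> n)"
proof -
  note N = n_bound_ge[OF assms(4)]
  let ?c = "real (n - K) + \<alpha> + 1"
  have Q: "Q_poly K \<gamma> = linear_factors (proots (Q_poly K \<gamma>))"
    using only_real_zeros_imp_linear_factors assms(3) Q_poly_monic(2)[of \<gamma> K] assms(2) by blast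
  have "x < ?c" if "x \<in># proots (Q_poly K \<gamma>)" for x
  proof (cases "x < \<alpha> + 1")
    case False
    with that have "x \<in> set (thetas \<alpha> K \<gamma>)" by (simp add: set_thetas)
    then obtain i where "i < length (thetas \<alpha> K \<gamma>)" "x = thetas \<alpha> K \<gamma> ! i" by (metis in_set_conv_nth)
    with N(2)[of i] show ?thesis by simp
  qed simp
  then have "zeros_positive_simple (poly_op ?c (linear_factors (proots (Q_poly K \<gamma>)) * 1) (monic_laguerre \<alpha> (n - K)))"
    by (intro poly_op_linear_factors_positive) (simp_all add: zeros_positive_simple_monic_laguerre assms(1))
  then show ?thesis
    unfolding q_poly_eq_poly_op[OF N(1)] using Q by (intro zeros_positive_simple_smult) auto
qed

text \<open>The largest \<open>\<theta>\<close> is used in the last raising step. All earlier steps have positive parameter, and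
  the last one keeps the zeros real and simple whatever its parameter is.\<close>

lemma zeros_real_simple_q_poly:
  assumes "\<alpha> > -1" "\<gamma> 0 = 1" "only_real_zeros (Q_poly K \<gamma>)" "int n \<ge> n_bound \<alpha> K \<gamma> 1"
  shows "zeros_real_simple (q_poly \<alpha> K \<gamma> n)"
proof (cases "thetas \<alpha> K \<gamma> = []")
  case True
  then have "n_bound \<alpha> K \<gamma> 0 = n_bound \<alpha> K \<gamma> 1" by (simp add: n_bound_def)
  with zeros_positive_simple_q_poly[of \<alpha> \<gamma> K n] assms show ?thesis
    by (simp add: zeros_positive_simple_iff)
next
  case False
  note N = n_bound_ge[OF assms(4)]
  let ?c = "real (n - K) + \<alpha> + 1" and ?A = "proots (Q_poly K \<gamma>)"
  define xs where "xs = thetas \<alpha> K \<gamma>"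
  define \<theta> where "\<theta> = last xs"
  define B where "B = filter_mset (\<lambda>x. \<not> \<alpha> + 1 \<le> x) ?A + mset (butlast xs)"
  have xs: "xs = butlast xs @ [\<theta>]" using False by (simp add: xs_def \<theta>_def)
  have "mset xs = add_mset \<theta> (mset (butlast xs))"
    by (subst xs) simp
  moreover have "mset xs = filter_mset (\<lambda>x. \<alpha> + 1 \<le> x) ?A" by (simp add: xs_def thetas_def)
  ultimately have A: "?A = add_mset \<theta> B"
    unfolding B_def by (metis multiset_partition add_mset_add_single union_commute union_mset_add_mset_right)
  have Q: "Q_poly K \<gamma> = linear_factors ?A"
    using only_real_zeros_imp_linear_factors assms(3) Q_poly_monic(2)[of \<gamma> K] assms(2) by blast
  have "x < ?c" if "x \<in># B" for x
  proof (cases "x \<in> set (butlast xs)")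
    case True
    then obtain i where "i < length (butlast xs)" "x = butlast xs ! i" by (metis in_set_conv_nth)
    with N(2)[of i] show ?thesis by (simp add: xs_def nth_butlast)
  qed (use that in \<open>auto simp: B_def\<close>)
  then have "zeros_positive_simple (poly_op ?c (linear_factors B * 1) (monic_laguerre \<alpha> (n - K)))"
    by (intro poly_op_linear_factors_positive) (simp_all add: zeros_positive_simple_monic_laguerre assms(1))
  then have "zeros_real_simple (euler_raise (?c + - \<theta>) (poly_op ?c (linear_factors B) (monic_laguerre \<alpha> (n - K))))"
    by (intro zeros_real_simple_raise) simp
  then have "zeros_real_simple (poly_op ?c (linear_factors ?A) (monic_laguerre \<alpha> (n - K)))"
    by (simp only: A linear_factors_simps poly_op_linear_factor)
  then show ?thesis
    unfolding q_poly_eq_poly_op[OF N(1)] using Q by (intro zeros_real_simple_smult) auto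
qed

lemma n_bound_eq_K:
  assumes "\<gamma> 0 = 1" "\<forall>x. poly (Q_poly K \<gamma>) x = 0 \<longrightarrow> x < \<alpha> + 1"
  shows "n_bound \<alpha> K \<gamma> l = int K"
proof -
  have "set (thetas \<alpha> K \<gamma>) = {}"
    using assms(2) Q_poly_monic(3)[of \<gamma> K, OF assms(1)] by (auto simp: set_thetas not_le)
  then show ?thesis by (simp add: n_bound_def)
qed

text \<open>The cofactor left after removing the real zeros is a function of the multiset of nonreal zeros
  alone. This makes the degree bound below independent of the real zeros less than \<open>\<alpha> + 1\<close>.\<close>

lemma cofactor_of_real_zeros:
  assumes "lead_coeff p = 1" "p = linear_factors (proots p) * r" "\<forall>x. poly r x \<noteq> 0"
  shows "cpoly r = (\<Prod>z\<in>#nonreal_zeros p. [:- z, 1:])" "lead_coeff r = 1"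
proof -
  show lr: "lead_coeff r = 1"
    using assms(1,2) lead_coeff_linear_factors[of "proots p"] by (metis lead_coeff_mult mult_1)
  then have r0: "r \<noteq> 0" by auto
  have l0: "linear_factors A \<noteq> 0" for A using lead_coeff_linear_factors[of A] by force
  have lin: "proots (cpoly (linear_factors A)) = image_mset complex_of_real A" for A
  proof (induction A)
    case (add x A)
    have "cpoly (linear_factors (add_mset x A)) = [:- complex_of_real x, 1:] * cpoly (linear_factors A)"
      by (simp only: linear_factors_simps cpoly_mult) (simp add: map_poly_pCons)
    moreover have "proots ([:- complex_of_real x, 1:] * cpoly (linear_factors A))
        = proots [:- complex_of_real x, 1:] + proots (cpoly (linear_factors A))"
      using l0[of A] by (intro proots_mult) auto
    ultimately show ?case using add by (simp only: proots_linear_factor) simp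
  qed simp
  have "proots (cpoly p) = image_mset complex_of_real (proots p) + proots (cpoly r)"
    by (subst assms(2)) (simp add: cpoly_mult proots_mult l0 r0 lin)
  moreover have "filter_mset (\<lambda>z. z \<notin> \<real>) (image_mset complex_of_real (proots p)) = {#}"
    by (auto simp: filter_mset_eq_conv)
  moreover have "filter_mset (\<lambda>z. z \<notin> \<real>) (proots (cpoly r)) = proots (cpoly r)"
    using assms(3) r0 by (auto simp: filter_mset_eq_conv elim!: Reals_cases simp: poly_cpoly_of_real)
  ultimately have "nonreal_zeros p = proots (cpoly r)" by (simp add: nonreal_zeros_def)
  moreover have "cpoly r = (\<Prod>z\<in>#proots (cpoly r). [:- z, 1:])"
    using complex_poly_decompose_multiset[of "cpoly r"] lr by (simp add: lead_coeff_cpoly)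
  ultimately show "cpoly r = (\<Prod>z\<in>#nonreal_zeros p. [:- z, 1:])" by simp
qed

text \<open>Expand \<open>P\<close> in the Pochhammer basis: the operator then produces some \<open>q\<^sub>n\<close>, for which the
  result for large degree is available.\<close>

lemma eventually_poly_op_positive:
  assumes "\<alpha> > -1" "lead_coeff P = 1"
  shows "eventually (\<lambda>k. zeros_positive_simple (poly_op (real k + \<alpha> + 1) P (monic_laguerre \<alpha> k))) sequentially"
proof -
  define K where "K = degree P"
  obtain \<gamma> where \<gamma>: "Q_poly K \<gamma> = P" using ex_Q_poly_eq[of P K] by (auto simp: K_def)
  then have \<gamma>0: "\<gamma> 0 = 1" using assms(2) coeff_Q_poly_top[of K \<gamma>] by (simp add: K_def)
  have "eventually (\<lambda>k. large_degree \<alpha> K \<gamma> (k + K)) sequentially"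
    using eventually_large_degree by (subst eventually_sequentially_seg)
  then show ?thesis
  proof eventually_elim
    case (elim k)
    have "zeros_positive_simple (smult ((-1) ^ K) (q_poly \<alpha> K \<gamma> (k + K)))"
      using q_poly_laguerre_signs(1)[of \<alpha> \<gamma> K, OF assms(1) \<gamma>0 elim] by (intro zeros_positive_simple_smult) auto
    then show ?case by (simp add: q_poly_eq_poly_op \<gamma> flip: power_mult_distrib)
  qed
qed

text \<open>First the cofactor with the nonreal zeros is applied, which gives positive simple zeros once the
  degree is large; then come the raising steps for the real zeros. For zeros less than \<open>\<alpha> + 1\<close> these
  have positive parameter in every degree, and for the finitely many others in every large degree.\<close>

lemma uniform_positivity_bound:
  assumes "\<alpha> > -1"
  shows "\<exists>N>0. \<forall>\<gamma>. \<gamma> 0 = 1 \<and> nonreal_zeros (Q_poly K \<gamma>) = M \<and> thetas \<alpha> K \<gamma> = ts \<longrightarrow>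
    (\<forall>n. n \<ge> K \<and> n \<ge> N \<longrightarrow> zeros_positive_simple (q_poly \<alpha> K \<gamma> n))"
proof (cases "\<exists>\<gamma>. \<gamma> 0 = 1 \<and> nonreal_zeros (Q_poly K \<gamma>) = M")
  case True
  then obtain \<gamma>0 where g0: "\<gamma>0 0 = 1" "nonreal_zeros (Q_poly K \<gamma>0) = M" by blast
  obtain r where r: "Q_poly K \<gamma>0 = linear_factors (proots (Q_poly K \<gamma>0)) * r" "\<forall>x. poly r x \<noteq> 0"
    using linear_factors_proots[OF Q_poly_monic(3)[of \<gamma>0 K]] g0(1) by blast
  note R = cofactor_of_real_zeros[OF Q_poly_monic(2)[of \<gamma>0 K, OF g0(1)] r]
  have "eventually (\<lambda>k. zeros_positive_simple (poly_op (real k + \<alpha> + 1) r (monic_laguerre \<alpha> k))) sequentially"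
    using assms R(2) by (rule eventually_poly_op_positive)
  moreover have "eventually (\<lambda>k. Max (insert 0 ((\<lambda>x. x - \<alpha> - 1) ` set ts)) < real k) sequentially"
    using filterlim_real_sequentially unfolding filterlim_at_top_dense by blast
  ultimately have "eventually (\<lambda>k. zeros_positive_simple (poly_op (real k + \<alpha> + 1) r (monic_laguerre \<alpha> k))
      \<and> real k > Max (insert 0 ((\<lambda>x. x - \<alpha> - 1) ` set ts))) sequentially"
    by (rule eventually_conj)
  then obtain N where N: "\<And>k. k \<ge> N \<Longrightarrow> zeros_positive_simple (poly_op (real k + \<alpha> + 1) r (monic_laguerre \<alpha> k))
      \<and> real k > Max (insert 0 ((\<lambda>x. x - \<alpha> - 1) ` set ts))"
    unfolding eventually_sequentially by blast
  show ?thesis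
  \<comment> \<open>\<open>N\<close> bounds the starting degree \<open>n - K\<close>; the successor makes the witness positive.\<close>
  proof (intro exI[of _ "Suc (N + K)"] conjI allI impI)
    fix \<gamma> n assume g: "\<gamma> 0 = 1 \<and> nonreal_zeros (Q_poly K \<gamma>) = M \<and> thetas \<alpha> K \<gamma> = ts"
      and n: "n \<ge> K \<and> n \<ge> Suc (N + K)"
    obtain r' where r': "Q_poly K \<gamma> = linear_factors (proots (Q_poly K \<gamma>)) * r'" "\<forall>x. poly r' x \<noteq> 0"
      using linear_factors_proots[OF Q_poly_monic(3)[of \<gamma> K]] g by blast
    have "cpoly r' = cpoly r"
      using cofactor_of_real_zeros(1)[OF Q_poly_monic(2)[of \<gamma> K] r'] R(1) g g0 by simp
    then have Q: "Q_poly K \<gamma> = linear_factors (proots (Q_poly K \<gamma>)) * r" using r'(1) by (simp add: cpoly_inject)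
    let ?c = "real (n - K) + \<alpha> + 1"
    have k: "n - K \<ge> N" using n by linarith
    have "x < ?c" if "x \<in># proots (Q_poly K \<gamma>)" for x
    proof (cases "x < \<alpha> + 1")
      case False
      with that g have "x \<in> set ts" using set_thetas[of \<alpha> K \<gamma>] by auto
      then have "x - \<alpha> - 1 \<le> Max (insert 0 ((\<lambda>x. x - \<alpha> - 1) ` set ts))" by (intro Max_ge) auto
      then show ?thesis using N[OF k] by linarith
    qed simp
    then have "zeros_positive_simple (poly_op ?c (linear_factors (proots (Q_poly K \<gamma>)) * r) (monic_laguerre \<alpha> (n - K)))"
      using N[OF k] by (intro poly_op_linear_factors_positive) auto
    then show "zeros_positive_simple (q_poly \<alpha> K \<gamma> n)"
      unfolding q_poly_eq_poly_op[OF conjunct1[OF n]] using Q by (intro zeros_positive_simple_smult) auto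
  qed simp
qed (auto intro!: exI[of _ 1])

theorem theorem1p3:
  fixes \<alpha> :: real and K :: nat
  assumes "\<alpha> > -1" and "K \<ge> 1"
  shows
    "(\<forall>\<gamma> :: nat \<Rightarrow> real. \<gamma> 0 = 1 \<and> \<gamma> K \<noteq> 0 \<and> only_real_zeros (Q_poly K \<gamma>) \<longrightarrow>
        (\<forall>n. int n \<ge> n_bound \<alpha> K \<gamma> 1 \<longrightarrow> zeros_real_simple (q_poly \<alpha> K \<gamma> n)) \<and>
        (\<forall>n. int n \<ge> n_bound \<alpha> K \<gamma> 0 \<longrightarrow> zeros_positive_simple (q_poly \<alpha> K \<gamma> n)) \<and>
        ((\<forall>x. poly (Q_poly K \<gamma>) x = 0 \<longrightarrow> x < \<alpha> + 1) \<longrightarrow>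
           n_bound \<alpha> K \<gamma> 0 = int K \<and> n_bound \<alpha> K \<gamma> 1 = int K))
     \<and>
     (\<exists>n\<^sub>0 :: complex multiset \<Rightarrow> real list \<Rightarrow> nat.
        \<forall>\<gamma> :: nat \<Rightarrow> real. \<gamma> 0 = 1 \<and> \<gamma> K \<noteq> 0 \<and> \<not> only_real_zeros (Q_poly K \<gamma>) \<longrightarrow>
          n\<^sub>0 (nonreal_zeros (Q_poly K \<gamma>)) (thetas \<alpha> K \<gamma>) > 0 \<and>
          (\<forall>n. n \<ge> K \<and> n \<ge> n\<^sub>0 (nonreal_zeros (Q_poly K \<gamma>)) (thetas \<alpha> K \<gamma>) \<longrightarrow>
             zeros_positive_simple (q_poly \<alpha> K \<gamma> n)))
     \<and>
     (\<forall>\<gamma> :: nat \<Rightarrow> real. \<gamma> 0 = 1 \<and> \<gamma> K \<noteq> 0 \<longrightarrow>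
        (\<forall>\<^sub>F n in sequentially.
           interlaces {x. poly (q_poly \<alpha> K \<gamma> (Suc n)) x = 0}
                      {x. poly (q_poly \<alpha> K \<gamma> n) x = 0}))"
proof (intro conjI allI impI)
  fix \<gamma> :: "nat \<Rightarrow> real" and n
  assume "\<gamma> 0 = 1 \<and> \<gamma> K \<noteq> 0 \<and> only_real_zeros (Q_poly K \<gamma>)" "int n \<ge> n_bound \<alpha> K \<gamma> 1"
  then show "zeros_real_simple (q_poly \<alpha> K \<gamma> n)"
    using zeros_real_simple_q_poly[of \<alpha> \<gamma> K n] assms(1) by blast
next
  fix \<gamma> :: "nat \<Rightarrow> real" and n
  assume "\<gamma> 0 = 1 \<and> \<gamma> K \<noteq> 0 \<and> only_real_zeros (Q_poly K \<gamma>)" "int n \<ge> n_bound \<alpha> K \<gamma> 0"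
  then show "zeros_positive_simple (q_poly \<alpha> K \<gamma> n)"
    using zeros_positive_simple_q_poly[of \<alpha> \<gamma> K n] assms(1) by blast
next
  fix \<gamma> :: "nat \<Rightarrow> real"
  assume "\<gamma> 0 = 1 \<and> \<gamma> K \<noteq> 0 \<and> only_real_zeros (Q_poly K \<gamma>)"
    and "\<forall>x. poly (Q_poly K \<gamma>) x = 0 \<longrightarrow> x < \<alpha> + 1"
  then show "n_bound \<alpha> K \<gamma> 0 = int K" "n_bound \<alpha> K \<gamma> 1 = int K"
    using n_bound_eq_K[of \<gamma> K \<alpha>] by blast+
next
  obtain n0 where "\<And>M ts. n0 M ts > 0 \<and> (\<forall>\<gamma>. \<gamma> 0 = 1 \<and> nonreal_zeros (Q_poly K \<gamma>) = M \<and> thetas \<alpha> K \<gamma> = ts \<longrightarrow>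
    (\<forall>n. n \<ge> K \<and> n \<ge> n0 M ts \<longrightarrow> zeros_positive_simple (q_poly \<alpha> K \<gamma> n)))"
    using uniform_positivity_bound[OF assms(1), of K] by metis
  then show "\<exists>n\<^sub>0 :: complex multiset \<Rightarrow> real list \<Rightarrow> nat.
        \<forall>\<gamma> :: nat \<Rightarrow> real. \<gamma> 0 = 1 \<and> \<gamma> K \<noteq> 0 \<and> \<not> only_real_zeros (Q_poly K \<gamma>) \<longrightarrow>
          n\<^sub>0 (nonreal_zeros (Q_poly K \<gamma>)) (thetas \<alpha> K \<gamma>) > 0 \<and>
          (\<forall>n. n \<ge> K \<and> n \<ge> n\<^sub>0 (nonreal_zeros (Q_poly K \<gamma>)) (thetas \<alpha> K \<gamma>) \<longrightarrow>
             zeros_positive_simple (q_poly \<alpha> K \<gamma> n))"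
    by (intro exI[of _ n0]) blast
next
  fix \<gamma> :: "nat \<Rightarrow> real"
  assume "\<gamma> 0 = 1 \<and> \<gamma> K \<noteq> 0"
  then show "\<forall>\<^sub>F n in sequentially.
           interlaces {x. poly (q_poly \<alpha> K \<gamma> (Suc n)) x = 0}
                      {x. poly (q_poly \<alpha> K \<gamma> n) x = 0}"
    using q_poly_Suc_interlaces[of \<alpha> \<gamma> K] assms(1)
    by (intro eventually_mono[OF eventually_large_degree[of \<alpha> K \<gamma>]]) blast
qed

end
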